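(* For every real $c\in(0,1)$ there exists $q_c$ such that the following holds for every even integer $q\geq q_c$. If $G$ is a $C_4$-free graph on $q^2+q+1$ vertices with at least $\frac12 q(q+1)^2-\frac{c}{2}q$ edges, then there exists a unique polarity graph $H$ of order $q$ on the vertex set $V(G)$ such that $G$ is a subgraph of $H$ (i.e. $E(G)\subseteq E(H)$).
   Context: A graph is $C_4$-free if it contains no cycle of length $4$ as a subgraph. A finite projective plane of order $q$ is a pair $(P,\mathcal L)$ where $P$ is a set of $q^2+q+1$ points and $\mathcal L$ is a family of $(q+1)$-element subsets of $P$ (lines) such that every point lies on exactly $q+1$ lines and any two distinct lines meet in exactly one point (hence $|\mathcal L|=q^2+q+1$ and any two points lie on a unique line). A polarity of a projective plane $(P,\mathcal L)$ is a bijection $\pi:P\cup\mathcal L\to P\cup\mathcal L$ with $\pi^2=\mathrm{id}$, $\pi(P)=\mathcal L$, $\pi(\mathcal L)=P$, such that for every point $x$ and line $L$, $x\in L$ implies $\pi(L)\in\pi(x)$. The polarity graph $G(\pi)$ is the simple graph on vertex set $P$ in which distinct $x,y$ are adjacent iff $x\in\pi(y)$. A polarity graph of order $q$ is a polarity graph arising from some projective plane of order $q$ and some polarity of it. *)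

theory Defs
  imports Complex_Main
begin

definition simple_graph :: "'a set \<Rightarrow> 'a set set \<Rightarrow> bool" where
  "simple_graph V E \<longleftrightarrow> finite V \<and> E \<subseteq> {e. e \<subseteq> V \<and> card e = 2}"

definition C4_free :: "'a set set \<Rightarrow> bool" where
  "C4_free E \<longleftrightarrow>
     \<not> (\<exists>a b c d. distinct [a, b, c, d] \<and>
          {a, b} \<in> E \<and> {b, c} \<in> E \<and> {c, d} \<in> E \<and> {d, a} \<in> E)"

text \<open>Finiteness of \<open>P\<close> follows from its cardinality being nonzero.\<close>

definition projective_plane :: "nat \<Rightarrow> 'a set \<Rightarrow> 'a set set \<Rightarrow> bool" where
  "projective_plane q P L \<longleftrightarrow>
     card P = q\<^sup>2 + q + 1 \<and>
     (\<forall>l\<in>L. l \<subseteq> P \<and> card l = q + 1) \<and>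
     (\<forall>x\<in>P. card {l \<in> L. x \<in> l} = q + 1) \<and>
     (\<forall>l\<in>L. \<forall>m\<in>L. l \<noteq> m \<longrightarrow> card (l \<inter> m) = 1)"

text \<open>Points and lines have different types, so the domain of a polarity is their disjoint
  union \<open>P <+> L\<close>: \<open>Inl x\<close> is the point \<open>x\<close> and \<open>Inr l\<close> the line \<open>l\<close>. Since \<open>\<pi>\<close> exchanges points
  and lines, \<open>projl (\<pi> (Inr l))\<close> is the point \<open>\<pi>(l)\<close> and \<open>projr (\<pi> (Inl x))\<close> the line \<open>\<pi>(x)\<close>;
  \<open>projl\<close> and \<open>projr\<close> are never applied outside their intended domain. Values of \<open>\<pi>\<close> outside
  \<open>P <+> L\<close> are irrelevant.\<close>

definition polarity ::
  "'a set \<Rightarrow> 'a set set \<Rightarrow> ('a + 'a set \<Rightarrow> 'a + 'a set) \<Rightarrow> bool" where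
  "polarity P L \<pi> \<longleftrightarrow>
     bij_betw \<pi> (P <+> L) (P <+> L) \<and>
     (\<forall>z \<in> P <+> L. \<pi> (\<pi> z) = z) \<and>
     \<pi> ` (Inl ` P) = Inr ` L \<and>
     \<pi> ` (Inr ` L) = Inl ` P \<and>
     (\<forall>x\<in>P. \<forall>l\<in>L. x \<in> l \<longrightarrow> projl (\<pi> (Inr l)) \<in> projr (\<pi> (Inl x)))"

definition polarity_graph_edges ::
  "'a set \<Rightarrow> ('a + 'a set \<Rightarrow> 'a + 'a set) \<Rightarrow> 'a set set" where
  "polarity_graph_edges P \<pi> =
     {{x, y} | x y. x \<in> P \<and> y \<in> P \<and> x \<noteq> y \<and> x \<in> projr (\<pi> (Inl y))}"

text \<open>\<open>F\<close> is the edge set of a polarity graph of order \<open>q\<close> with vertex set \<open>V\<close>.\<close>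

definition polarity_graph :: "nat \<Rightarrow> 'a set \<Rightarrow> 'a set set \<Rightarrow> bool" where
  "polarity_graph q V F \<longleftrightarrow>
     (\<exists>L \<pi>. projective_plane q V L \<and> polarity V L \<pi> \<and> F = polarity_graph_edges V \<pi>)"

end

theory Submission
  imports Defs "HOL-Analysis.Convex" "HOL-Real_Asymp.Real_Asymp"
begin

text \<open>Measure a vertex by its defect \<open>q + 1 - deg\<close>. The hypothesis on the number of edges says that
  the defects add up to at most \<open>(2 - 2\<epsilon>) q\<close>. For even \<open>q\<close> a vertex of degree \<open>q + 1\<close> has an odd
  number of neighbours with which it has no common neighbour, and comparing walks of length three
  shows that, up to few exceptions, such edges end in a deficient vertex all of whose edges lie in
  no triangle. There are at least \<open>(1 - \<epsilon>) q\<close> such deficient vertices, and they must be absolute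
  points: adding loops at them brings the total defect below \<open>q\<close>. Now the neighbourhoods of the
  vertices of full degree are lines that meet pairwise in exactly one point, and at most \<open>q\<close> lines
  are missing. A double count finds a point on exactly one missing line, which is therefore
  determined; so the lines can be completed, in a unique way, one after the other.

  Vertices of degree greater than \<open>q + 1\<close> number only \<open>O(\<surd>q)\<close>. Deleting one edge at each of them
  gives a graph to which the argument applies, but the polarity graph found in this way would miss
  about \<open>q\<close> edges of the original one.\<close>

section \<open>Symmetric relations in which two points have at most one common neighbour\<close>

text \<open>A polarity graph with exactly \<open>q + 1\<close> absolute points has total defect
  \<open>q + 1\<close>, and its number of edges is the main term of the hypothesis. The term with
  \<open>c\<close> allows about \<open>c * q\<close> units of defect beyond that, so the total stays
  below \<open>2 * q\<close> by a fixed proportion. The obstacle is that completing the lines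
  tolerates fewer than \<open>q\<close> units. Absolute points therefore have to be recognised
  before there is a plane, and parity is what produces nearly \<open>q\<close> candidates. Two
  estimates carry the counting. The size of \<open>unlinked x\<close> is
  \<open>q * defect x + ndefect x\<close>, so for a full vertex the global property of sharing no
  neighbour is governed by the defect visible in \<open>N x\<close>. If no defect is negative,
  \<open>ndefect\<close> sums to at most \<open>total\<close> over the neighbourhood of a full
  vertex; with a total below \<open>2 * q\<close> its average there is below 2. Secondly, by
  Cauchy-Schwarz, few vertices can have linearly many neighbours in a set of size
  \<open>O(q)\<close>; this bounds most exceptional sets.\<close>

lemma sum_Int_restrict:
  "finite Y \<Longrightarrow> sum g (A \<inter> Y) = (\<Sum>u\<in>Y. if u \<in> A then g u else 0)"
  by (subst Int_commute) (rule sum.inter_restrict)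

text \<open>Loops \<open>x \<in> N x\<close> are allowed: they represent absolute points.\<close>

locale c4free_rel =
  fixes V :: "'a set" and N :: "'a \<Rightarrow> 'a set" and q :: nat
  assumes finV: "finite V"
    and cardV: "card V = q\<^sup>2 + q + 1"
    and N_sub: "x \<in> V \<Longrightarrow> N x \<subseteq> V"
    and N_sym: "x \<in> V \<Longrightarrow> y \<in> N x \<Longrightarrow> x \<in> N y"
    and codeg: "\<lbrakk>x \<in> V; y \<in> V; x \<noteq> y; a \<in> N x; a \<in> N y; b \<in> N x; b \<in> N y\<rbrakk> \<Longrightarrow> a = b"
begin

definition defect :: "'a \<Rightarrow> int" where
  "defect x = int q + 1 - int (card (N x))"

definition unlinked :: "'a \<Rightarrow> 'a set" where
  "unlinked x = {y \<in> V. y \<noteq> x \<and> N x \<inter> N y = {}}"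

definition ndefect :: "'a \<Rightarrow> int" where
  "ndefect x = (\<Sum>u\<in>N x. defect u)"

definition total :: int where
  "total = (\<Sum>x\<in>V. defect x)"

lemma finN: "x \<in> V \<Longrightarrow> finite (N x)"
  using N_sub finV finite_subset by blast

lemma N_in_V: "x \<in> V \<Longrightarrow> y \<in> N x \<Longrightarrow> y \<in> V"
  using N_sub by blast

lemma N_sym_iff: "x \<in> V \<Longrightarrow> y \<in> V \<Longrightarrow> y \<in> N x \<longleftrightarrow> x \<in> N y"
  using N_sym by blast

lemma card_N: "int (card (N x)) = int q + 1 - defect x"
  by (simp add: defect_def)

lemma unlinked_sub: "unlinked x \<subseteq> V"
  by (auto simp: unlinked_def)

lemma fin_unlinked: "finite (unlinked x)"
  using unlinked_sub finV finite_subset by blast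

lemma unlinked_sym: "x \<in> V \<Longrightarrow> y \<in> unlinked x \<Longrightarrow> x \<in> unlinked y"
  by (auto simp: unlinked_def)

lemma not_self_unlinked: "x \<notin> unlinked x"
  by (simp add: unlinked_def)

lemma unlinked_no_common: "y \<in> unlinked x \<Longrightarrow> z \<in> N x \<Longrightarrow> z \<in> N y \<Longrightarrow> False"
  by (auto simp: unlinked_def)

lemma codeg_le: "\<lbrakk>x \<in> V; y \<in> V; x \<noteq> y\<rbrakk> \<Longrightarrow> card (N x \<inter> N y) \<le> 1"
  using codeg[of x y] finN[of x] by (auto simp: card_le_Suc0_iff_eq)

lemma card_common:
  assumes "a \<in> V" "z \<in> V"
  shows "card (N a \<inter> N z) = (if a = z then card (N z) else if a \<in> unlinked z then 0 else 1)"
proof (cases "a = z \<or> a \<in> unlinked z")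
  case True
  then show ?thesis by (auto simp: unlinked_def Int_commute)
next
  case False
  then have ne: "N a \<inter> N z \<noteq> {}" using assms by (auto simp: unlinked_def)
  have "finite (N a \<inter> N z)" using finN assms by blast
  then have "card (N a \<inter> N z) \<noteq> 0" using ne by simp
  then have "card (N a \<inter> N z) = 1" using codeg_le[of a z] assms False by force
  then show ?thesis using False by simp
qed

lemma sum_over_nbrs:
  fixes g :: "'a \<Rightarrow> 'b::comm_semiring_1"
  assumes "X \<subseteq> V" "Y \<subseteq> V"
  shows "(\<Sum>t\<in>X. \<Sum>u\<in>N t \<inter> Y. g u) = (\<Sum>u\<in>Y. g u * of_nat (card (N u \<inter> X)))"
proof -
  have fX: "finite X" and fY: "finite Y" using assms finV finite_subset by blast+
  have "(\<Sum>t\<in>X. \<Sum>u\<in>N t \<inter> Y. g u) = (\<Sum>t\<in>X. \<Sum>u\<in>Y. if u \<in> N t then g u else 0)"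
    by (rule sum.cong[OF refl]) (rule sum_Int_restrict[OF fY])
  also have "\<dots> = (\<Sum>u\<in>Y. \<Sum>t\<in>X. if u \<in> N t then g u else 0)"
    by (rule sum.swap)
  also have "\<dots> = (\<Sum>u\<in>Y. \<Sum>t\<in>X. if t \<in> N u then g u else 0)"
    using assms by (intro sum.cong refl) (use N_sym_iff in \<open>auto\<close>)
  also have "\<dots> = (\<Sum>u\<in>Y. \<Sum>t\<in>N u \<inter> X. g u)"
    by (rule sum.cong[OF refl]) (rule sum_Int_restrict[OF fX, symmetric])
  also have "\<dots> = (\<Sum>u\<in>Y. g u * of_nat (card (N u \<inter> X)))"
    by (simp add: mult.commute)
  finally show ?thesis .
qed

lemma edges_between_commute:
  assumes "X \<subseteq> V" "Y \<subseteq> V"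
  shows "(\<Sum>t\<in>X. card (N t \<inter> Y)) = (\<Sum>u\<in>Y. card (N u \<inter> X))"
  using sum_over_nbrs[OF assms, of "\<lambda>_. 1::nat"] by simp

lemma sum_ndefect:
  assumes "X \<subseteq> V"
  shows "(\<Sum>t\<in>X. ndefect t) = (\<Sum>u\<in>V. defect u * int (card (N u \<inter> X)))"
proof -
  have "(\<Sum>t\<in>X. ndefect t) = (\<Sum>t\<in>X. \<Sum>u\<in>N t \<inter> V. defect u)"
    unfolding ndefect_def using assms N_sub by (intro sum.cong refl) (metis inf.absorb1 subsetD)
  then show ?thesis using sum_over_nbrs[OF assms, of V defect] by simp
qed

text \<open>The weight \<open>card (N u \<inter> N x)\<close> is 1 except at \<open>u = x\<close>
  and on \<open>unlinked x\<close>; the two correction terms come from there.\<close>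

lemma sum_codeg:
  fixes g :: "'a \<Rightarrow> int"
  assumes x: "x \<in> V"
  shows "(\<Sum>u\<in>V. g u * int (card (N u \<inter> N x)))
     = g x * (int (card (N x)) - 1) + (\<Sum>u\<in>V. g u) - (\<Sum>u\<in>unlinked x. g u)"
proof -
  have "(\<Sum>u\<in>V. g u * int (card (N u \<inter> N x)))
     = (\<Sum>u\<in>V. g u + ((if u = x then g u * (int (card (N x)) - 1) else 0) - (if u \<in> unlinked x then g u else 0)))"
    using x by (intro sum.cong refl) (auto simp: card_common not_self_unlinked algebra_simps)
  also have "\<dots> = (\<Sum>u\<in>V. g u) + ((\<Sum>u\<in>V. if u = x then g u * (int (card (N x)) - 1) else 0) - (\<Sum>u\<in>V. if u \<in> unlinked x then g u else 0))"
    by (simp add: sum.distrib sum_subtractf)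
  also have "(\<Sum>u\<in>V. if u = x then g u * (int (card (N x)) - 1) else 0) = g x * (int (card (N x)) - 1)"
    using x finV by simp
  also have "(\<Sum>u\<in>V. if u \<in> unlinked x then g u else 0) = (\<Sum>u\<in>unlinked x. g u)"
    using finV unlinked_sub[of x] by (simp add: sum.inter_restrict[symmetric] Int_absorb1)
  finally show ?thesis by simp
qed

text \<open>Count the walks of length two from \<open>x\<close>, once by the middle vertex and once
  by the last vertex. The size of \<open>V\<close> is chosen such that all constants cancel.\<close>

lemma card_unlinked:
  assumes x: "x \<in> V"
  shows "int (card (unlinked x)) = int q * defect x + ndefect x"
proof -
  have "(\<Sum>t\<in>N x. int (card (N t))) = (\<Sum>t\<in>N x. int (card (N t \<inter> V)))"
    using x N_sub N_in_V by (intro sum.cong refl) (metis inf.absorb1)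
  also have "\<dots> = (\<Sum>u\<in>V. 1 * int (card (N u \<inter> N x)))"
    using edges_between_commute[of "N x" V] N_sub[OF x] by (simp flip: of_nat_sum)
  also have "\<dots> = int (card (N x)) - 1 + int (card V) - int (card (unlinked x))"
    using sum_codeg[OF x, of "\<lambda>_. 1"] by simp
  finally have 1: "(\<Sum>t\<in>N x. int (card (N t))) = int (card (N x)) - 1 + int (card V) - int (card (unlinked x))" .
  have "(\<Sum>t\<in>N x. int (card (N t))) = int (card (N x)) * (int q + 1) - ndefect x"
  proof -
    have "(\<Sum>t\<in>N x. int (card (N t))) = (\<Sum>t\<in>N x. (int q + 1) - defect t)"
      by (rule sum.cong) (simp_all add: defect_def)
    then show ?thesis by (simp add: sum_subtractf ndefect_def)
  qed
  with 1 have "int (card (unlinked x)) = int (card V) - 1 - int q * int (card (N x)) + ndefect x"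
    by (simp add: algebra_simps)
  then show ?thesis by (simp add: cardV card_N algebra_simps power2_eq_square)
qed

text \<open>Both sides count the walks of length three between \<open>x\<close> and \<open>z\<close>.\<close>

lemma walk3_identity:
  assumes x: "x \<in> V" and z: "z \<in> V" and ne: "x \<noteq> z"
  shows "int (card (N x \<inter> unlinked z)) + defect x + (if z \<in> N x then defect z else 0)
       = int (card (N z \<inter> unlinked x)) + defect z + (if z \<in> N x then defect x else 0)"
proof -
  have walk: "int (\<Sum>a\<in>N x. card (N a \<inter> N z))
      = int (card (N x)) - int (card (N x \<inter> unlinked z)) + (if z \<in> N x then int (card (N z)) - 1 else 0)"
    if x: "x \<in> V" and z: "z \<in> V" for x z
  proof -
    have f: "finite (N x)" using finN x .
    have "int (\<Sum>a\<in>N x. card (N a \<inter> N z))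
      = (\<Sum>a\<in>N x. 1 - (if a \<in> unlinked z then 1 else 0) + (if a = z then int (card (N z)) - 1 else 0))"
      unfolding of_nat_sum using x z N_in_V by (intro sum.cong refl) (auto simp: card_common not_self_unlinked)
    also have "\<dots> = int (card (N x)) - (\<Sum>a\<in>N x. if a \<in> unlinked z then 1 else 0) + (\<Sum>a\<in>N x. if a = z then int (card (N z)) - 1 else 0)"
      by (simp add: sum.distrib sum_subtractf)
    also have "(\<Sum>a\<in>N x. if a \<in> unlinked z then 1 else (0::int)) = int (card (N x \<inter> unlinked z))"
      using f by (simp add: sum.inter_restrict[symmetric])
    also have "(\<Sum>a\<in>N x. if a = z then int (card (N z)) - 1 else 0) = (if z \<in> N x then int (card (N z)) - 1 else 0)"
      using f by simp
    finally show ?thesis .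
  qed
  have "(\<Sum>a\<in>N x. card (N a \<inter> N z)) = (\<Sum>a\<in>N z. card (N a \<inter> N x))"
    using edges_between_commute[of "N x" "N z"] N_sub x z by blast
  with walk[OF x z] walk[OF z x] show ?thesis
    using N_sym_iff[OF x z] by (auto simp: card_N split: if_splits)
qed

text \<open>Walks of length two from \<open>x\<close>, weighted by the defect of the last vertex.
  For full \<open>x\<close> and nonnegative defects this makes \<open>total\<close> a budget shared
  by the neighbours of \<open>x\<close>.\<close>

lemma sum_ndefect_nbrs:
  assumes x: "x \<in> V"
  shows "(\<Sum>t\<in>N x. ndefect t) = total + defect x * (int q - defect x) - (\<Sum>u\<in>unlinked x. defect u)"
  using sum_ndefect[of "N x"] sum_codeg[OF x, of defect] N_sub[OF x] by (simp add: total_def card_N)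

text \<open>The Kovari-Sos-Turan argument: Cauchy-Schwarz over \<open>Y\<close> bounds the square of
  the edge count by a count of pairs in \<open>X\<close> with a common neighbour in
  \<open>Y\<close>, and distinct vertices have at most one.\<close>

lemma edges_between_bound:
  assumes X: "X \<subseteq> V" and Y: "Y \<subseteq> V"
  shows "real (\<Sum>x\<in>X. card (N x \<inter> Y)) \<le> real (card Y) + real (card X) * sqrt (real (card Y))"
proof -
  have fX: "finite X" and fY: "finite Y" using X Y finV finite_subset by blast+
  define L where "L = (\<Sum>x\<in>X. card (N x \<inter> Y))"
  define c where "c y = card (N y \<inter> X)" for y
  have L: "L = (\<Sum>y\<in>Y. c y)" unfolding L_def c_def by (rule edges_between_commute[OF X Y])
  have 1: "(real L)\<^sup>2 \<le> (\<Sum>y\<in>Y. (real (c y))\<^sup>2) * real (card Y)"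
    unfolding L of_nat_sum using sum_squared_le_sum_of_squares[of "\<lambda>y. real (c y)" Y] by simp
  have "(\<Sum>y\<in>Y. (c y)\<^sup>2) = (\<Sum>y\<in>Y. \<Sum>x\<in>N y \<inter> X. c y)"
    by (simp add: power2_eq_square c_def)
  also have "\<dots> = (\<Sum>y\<in>Y. \<Sum>x\<in>X. if x \<in> N y then c y else 0)"
    by (rule sum.cong[OF refl]) (rule sum_Int_restrict[OF fX])
  also have "\<dots> = (\<Sum>x\<in>X. \<Sum>y\<in>Y. if x \<in> N y then c y else 0)" by (rule sum.swap)
  also have "\<dots> = (\<Sum>x\<in>X. \<Sum>y\<in>Y. if y \<in> N x then c y else 0)"
    using X Y N_sym_iff by (intro sum.cong refl) (auto)
  also have "\<dots> = (\<Sum>x\<in>X. \<Sum>y\<in>N x \<inter> Y. card (N y \<inter> X))"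
    unfolding c_def by (rule sum.cong[OF refl]) (rule sum_Int_restrict[OF fY, symmetric])
  also have "\<dots> = (\<Sum>x\<in>X. \<Sum>x'\<in>X. card (N x' \<inter> (N x \<inter> Y)))"
    using X Y by (intro sum.cong[OF refl] edges_between_commute) auto
  also have "\<dots> \<le> (\<Sum>x\<in>X. \<Sum>x'\<in>X. 1 + (if x' = x then card (N x \<inter> Y) else 0))"
  proof (intro sum_mono)
    fix x x' assume a: "x \<in> X" "x' \<in> X"
    show "card (N x' \<inter> (N x \<inter> Y)) \<le> 1 + (if x' = x then card (N x \<inter> Y) else 0)"
    proof (cases "x' = x")
      case False
      have "card (N x' \<inter> (N x \<inter> Y)) \<le> card (N x' \<inter> N x)"
        using finN[of x'] a X by (intro card_mono) auto
      then show ?thesis using codeg_le[of x' x] a X False by fastforce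
    qed simp
  qed
  also have "\<dots> = (card X)\<^sup>2 + L"
    unfolding sum.distrib using fX by (simp add: power2_eq_square L_def)
  finally have 2: "(\<Sum>y\<in>Y. (c y)\<^sup>2) \<le> (card X)\<^sup>2 + L" .
  have "(\<Sum>y\<in>Y. (real (c y))\<^sup>2) = real (\<Sum>y\<in>Y. (c y)\<^sup>2)" by simp
  also have "\<dots> \<le> real ((card X)\<^sup>2 + L)" using 2 by (rule of_nat_mono)
  finally have 3: "(real L)\<^sup>2 \<le> real ((card X)\<^sup>2 + L) * real (card Y)"
    using 1 by (meson mult_right_mono of_nat_0_le_iff order_trans)
  define l m s where "l = real L" and "m = real (card X)" and "s = sqrt (real (card Y))"
  have s2: "real (card Y) = s\<^sup>2" by (simp add: s_def)
  have nn: "0 \<le> l" "0 \<le> m" "0 \<le> s" by (auto simp: l_def m_def s_def)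
  have le: "l * l \<le> (m\<^sup>2 + l) * s\<^sup>2"
    using 3 by (simp add: l_def m_def s2 power2_eq_square)
  \<comment> \<open>Solves the quadratic inequality \<open>le\<close>: a larger \<open>l\<close>
    would make \<open>l * l\<close> exceed \<open>l * s\<^sup>2 + (m * s)\<^sup>2\<close>.\<close>
  have "l \<le> s\<^sup>2 + m * s"
  proof (rule ccontr)
    assume a: "\<not> ?thesis"
    have ms: "0 \<le> m * s" using nn by simp
    have l: "m * s \<le> l" "0 < l" using a ms by (auto simp: not_le intro: order_trans less_imp_le add_increasing)
       (smt (verit) zero_le_power2)+
    have "l * (s\<^sup>2 + m * s) < l * l" using a l by (intro mult_strict_left_mono) auto
    moreover have "(m * s) * (m * s) \<le> l * (m * s)" using l ms by (intro mult_right_mono)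
    ultimately show False using le by (simp add: power2_eq_square algebra_simps)
  qed
  then show ?thesis using nn(3) by (simp add: l_def m_def s2 s_def[symmetric] L_def[symmetric])
qed

end

section \<open>Completing a partial polarity\<close>

text \<open>\<open>R x\<close> plays the line paired with the point \<open>x\<close>, and
  \<open>G\<close> holds the points whose line is already known. Indexing lines by points turns the
  polarity condition into symmetry of incidence, demanded only inside \<open>G\<close>; for
  \<open>G = V\<close> this is a full polarity.\<close>

definition partial_polarity :: "nat \<Rightarrow> 'a set \<Rightarrow> 'a set \<Rightarrow> ('a \<Rightarrow> 'a set) \<Rightarrow> bool" where
  "partial_polarity q V G R \<longleftrightarrow> G \<subseteq> V \<and>
     (\<forall>x\<in>G. R x \<subseteq> V \<and> card (R x) = q + 1) \<and>
     (\<forall>x\<in>G. \<forall>y\<in>G. x \<noteq> y \<longrightarrow> card (R x \<inter> R y) = 1) \<and>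
     (\<forall>x\<in>G. \<forall>y\<in>G. y \<in> R x \<longleftrightarrow> x \<in> R y)"

lemma partial_polarityD:
  assumes "partial_polarity q V G R"
  shows "G \<subseteq> V" "x \<in> G \<Longrightarrow> R x \<subseteq> V" "x \<in> G \<Longrightarrow> card (R x) = q + 1"
    "x \<in> G \<Longrightarrow> finite (R x)"
    "x \<in> G \<Longrightarrow> y \<in> G \<Longrightarrow> x \<noteq> y \<Longrightarrow> card (R x \<inter> R y) = 1"
    "x \<in> G \<Longrightarrow> y \<in> G \<Longrightarrow> x \<noteq> y \<Longrightarrow> \<exists>u. R x \<inter> R y = {u}"
    "x \<in> G \<Longrightarrow> y \<in> R x \<Longrightarrow> y \<in> G \<Longrightarrow> x \<in> R y"
  using assms unfolding partial_polarity_def by (auto simp: card_1_singleton_iff intro: card_ge_0_finite)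

lemma partial_polarity_meet_unique:
  assumes "partial_polarity q V G R" "x \<in> G" "y \<in> G" "x \<noteq> y" "a \<in> R x" "a \<in> R y" "b \<in> R x" "b \<in> R y"
  shows "a = b"
  using partial_polarityD(6)[OF assms(1-4)] assms(5-8) by (metis IntI singletonD)

text \<open>With \<open>j z\<close> the number of missing lines through \<open>z\<close> and \<open>M\<close> the number of all missing
  lines, \<open>\<Sum> j = M (q + 1)\<close> and \<open>\<Sum> j (j - 1) = M (M - 1)\<close>; hence more than \<open>M\<close> points lie on
  exactly one missing line, and one of them belongs to \<open>G\<close>.\<close>

lemma exists_point_on_one_missing_line:
  assumes pp: "partial_polarity q V G R" and fV: "finite V" and cV: "card V = q\<^sup>2 + q + 1"
    and ne: "G \<noteq> V" and le: "card (V - G) \<le> q"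
  obtains z s where "z \<in> G" "s \<in> V - G" "R z \<inter> (V - G) = {s}"
proof -
  have GV: "G \<subseteq> V" and fG: "finite G" using pp fV finite_subset unfolding partial_polarity_def by auto
  define r where "r z = int (card {x \<in> G. z \<in> R x})" for z
  \<comment> \<open>Nothing guarantees yet that at most \<open>q + 1\<close> known lines pass
    through \<open>z\<close>, so \<open>j z\<close> may be negative and has to be an
    integer.\<close>
  define j where "j z = int q + 1 - r z" for z
  define n m k where "n = int (card V)" and "m = int (card (V - G))" and "k = int (card G)"
  have k: "k = n - m" using GV fV by (simp add: n_def m_def k_def card_Diff_subset fG card_mono of_nat_diff)
  have n: "n = int q * int q + int q + 1" by (simp add: n_def cV power2_eq_square)
  have m: "0 < m" "m \<le> int q" using ne GV fV le by (auto simp: m_def card_gt_0_iff)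
  have r: "r z = (\<Sum>x\<in>G. if z \<in> R x then 1 else 0)" for z
  proof -
    have "{x \<in> G. z \<in> R x} = G \<inter> {x. z \<in> R x}" by blast
    then show ?thesis using fG by (simp add: r_def sum.If_cases)
  qed
  have sum_R: "(\<Sum>z\<in>V. if z \<in> R x then f z else 0) = sum f (R x)" if "x \<in> G" for x and f :: "'a \<Rightarrow> int"
    using partial_polarityD(2)[OF pp that] fV by (simp add: sum.inter_restrict[symmetric] Int_absorb1)
  have sum_r: "(\<Sum>z\<in>V. r z * f z) = (\<Sum>x\<in>G. sum f (R x))" for f :: "'a \<Rightarrow> int"
  proof -
    have "(\<Sum>z\<in>V. r z * f z) = (\<Sum>z\<in>V. \<Sum>x\<in>G. if z \<in> R x then f z else 0)"
      unfolding r sum_distrib_right by (intro sum.cong refl) auto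
    also have "\<dots> = (\<Sum>x\<in>G. \<Sum>z\<in>V. if z \<in> R x then f z else 0)" by (rule sum.swap)
    also have "\<dots> = (\<Sum>x\<in>G. sum f (R x))" using sum_R by (rule sum.cong[OF refl])
    finally show ?thesis .
  qed
  have s1: "(\<Sum>z\<in>V. r z) = k * (int q + 1)"
    using sum_r[of "\<lambda>_. 1"] partial_polarityD(3)[OF pp] by (simp add: k_def)
  have "(\<Sum>z\<in>V. r z * r z) = (\<Sum>x\<in>G. sum r (R x))" by (rule sum_r)
  also have "\<dots> = (\<Sum>x\<in>G. k + int q)"
  proof (rule sum.cong[OF refl])
    fix x assume x: "x \<in> G"
    have "sum r (R x) = (\<Sum>z\<in>R x. \<Sum>y\<in>G. if z \<in> R y then 1 else 0)" by (simp add: r)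
    also have "\<dots> = (\<Sum>y\<in>G. \<Sum>z\<in>R x. if z \<in> R y then 1 else 0)" by (rule sum.swap)
    also have "\<dots> = (\<Sum>y\<in>G. int (card (R x \<inter> R y)))"
      using partial_polarityD(4)[OF pp x] by (simp add: sum.If_cases)
    also have "\<dots> = (\<Sum>y\<in>G. 1 + (if y = x then int q else 0))"
      using partial_polarityD(3)[OF pp x] partial_polarityD(5)[OF pp x] by (intro sum.cong refl) auto
    also have "\<dots> = k + int q" using x fG by (simp add: sum.distrib k_def)
    finally show "sum r (R x) = k + int q" .
  qed
  finally have s2: "(\<Sum>z\<in>V. r z * r z) = k * (k + int q)" by (simp add: k_def)
  have "(\<Sum>z\<in>V. j z * (2 - j z)) = (\<Sum>z\<in>V. (1 - int q * int q) + 2 * int q * r z - r z * r z)"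
    by (rule sum.cong) (auto simp: j_def algebra_simps)
  also have "\<dots> = n * (1 - int q * int q) + 2 * int q * (k * (int q + 1)) - k * (k + int q)"
    by (simp add: sum.distrib sum_subtractf s1[symmetric] s2[symmetric] sum_distrib_left n_def)
  also have "\<dots> = m * (int q + 2 - m)" unfolding k n by (simp add: algebra_simps)
  finally have tot: "(\<Sum>z\<in>V. j z * (2 - j z)) = m * (int q + 2 - m)" .
  \<comment> \<open>This product is 1 for \<open>j z = 1\<close> and at most 0 otherwise. Its sum
    \<open>m * (int q + 2 - m)\<close> is at least \<open>2 * m\<close>, so the \<open>m\<close>
    points outside \<open>G\<close> cannot account for it.\<close>
  have j1: "j z * (2 - j z) \<le> 1" for z
    using zero_le_power2[of "j z - 1"] by (simp add: power2_eq_square algebra_simps)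
  have j0: "j z * (2 - j z) \<le> 0" if "j z \<noteq> 1" for z
    using that by (cases "j z \<le> 0") (auto simp: mult_nonpos_nonneg mult_nonneg_nonpos)
  have "\<exists>z\<in>G. j z = 1"
  proof (rule ccontr)
    assume a: "\<not> ?thesis"
    have "(\<Sum>z\<in>V. j z * (2 - j z)) \<le> (\<Sum>z\<in>V. if z \<in> V - G then 1 else 0)"
      using a j0 j1 by (intro sum_mono) auto
    also have "\<dots> = m"
    proof -
      have "V \<inter> {z. z \<in> V - G} = V - G" by blast
      then show ?thesis using fV by (simp only: sum.If_cases m_def) simp
    qed
    finally have "m * (int q + 2 - m) \<le> m * 1" unfolding tot by simp
    then show False using m by (simp add: mult_le_cancel_left)
  qed
  then obtain z where z: "z \<in> G" "j z = 1" by blast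
  \<comment> \<open>By symmetry the known lines through \<open>z\<close> belong to the points of
    \<open>R z\<close> in \<open>G\<close>. Hence \<open>j z = 1\<close> says that all but one point
    of \<open>R z\<close> lie in \<open>G\<close>.\<close>
  have "{x \<in> G. z \<in> R x} = R z \<inter> G"
    using partial_polarityD(7)[OF pp] z(1) by blast
  then have "card (R z \<inter> G) = q" using z(2) by (simp add: j_def r_def)
  moreover have "card (R z) = card (R z \<inter> G) + card (R z \<inter> (V - G))"
    using partial_polarityD(2,4)[OF pp z(1)] by (subst card_Un_disjoint[symmetric]) (auto intro!: arg_cong[where f=card])
  ultimately have "card (R z \<inter> (V - G)) = 1" using partial_polarityD(3)[OF pp z(1)] by simp
  then obtain s where "R z \<inter> (V - G) = {s}" by (auto simp: card_1_singleton_iff)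
  then show thesis using that z(1) by blast
qed

text \<open>The lines through \<open>z\<close> are those of the points of \<open>R z\<close>, and
  only the line of \<open>s\<close> is unknown. Lines through \<open>z\<close> partition the other
  points of a plane, so the missing line must be \<open>A\<close>: the point \<open>z\<close> and
  whatever the \<open>q\<close> known lines leave over.\<close>

lemma partial_polarity_extend_one:
  assumes pp: "partial_polarity q V G R" and fV: "finite V" and cV: "card V = q\<^sup>2 + q + 1"
    and z: "z \<in> G" and s: "s \<in> V - G" and zs: "R z \<inter> (V - G) = {s}"
  defines "A \<equiv> {w \<in> V. w = z \<or> (\<forall>x\<in>R z \<inter> G. w \<notin> R x)}"
  shows "partial_polarity q V (insert s G) (R(s := A))"
proof -
  note D = partial_polarityD[OF pp]
  note uniq = partial_polarity_meet_unique[OF pp]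
  let ?P = "R z \<inter> G"
  have zV: "z \<in> V" using D(1) z by blast
  have Rz: "R z = insert s ?P" "s \<notin> ?P" using zs D(2)[OF z] s by auto
  have fP: "finite ?P" using D(4)[OF z] by simp
  have cP: "card ?P = q" using Rz D(3)[OF z] fP by (metis card_insert_disjoint Suc_eq_plus1 add_right_cancel)
  have zin: "z \<in> R x" if "x \<in> ?P" for x using that D(7)[OF z] by blast
  have AV: "A \<subseteq> V" by (auto simp: A_def)
  let ?U = "\<Union>x\<in>?P. R x - {z}"
  have cU: "card ?U = q * q"
  proof -
    have "card ?U = (\<Sum>x\<in>?P. card (R x - {z}))"
    proof (intro card_UN_disjoint ballI impI)
      fix x y assume "x \<in> ?P" "y \<in> ?P" "x \<noteq> y"
      then show "(R x - {z}) \<inter> (R y - {z}) = {}" using uniq[of x y _ z] zin by blast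
    qed (use fP D(4) in auto)
    also have "\<dots> = (\<Sum>x\<in>?P. q)" using zin D(3,4) by (intro sum.cong refl) auto
    finally show ?thesis using cP by simp
  qed
  have fU: "finite ?U" using fP D(4) by auto
  have "A = V - ?U" unfolding A_def using zV zin by auto
  moreover have UV: "?U \<subseteq> V" using D(2) by blast
  ultimately have cA: "card A = q + 1" using cU fU cV by (simp add: card_Diff_subset power2_eq_square)
  have zA: "z \<in> A" using zV by (simp add: A_def)
  have meet: "card (R x \<inter> A) = 1" if x: "x \<in> G" for x
  proof (cases "z \<in> R x")
    case True
    then have "x \<in> ?P" using D(7)[OF x True z] x by blast
    then have "R x \<inter> A = {z}" using True zA by (auto simp: A_def)
    then show ?thesis by simp
  next
    case False
    have ex: "\<exists>!u. u \<in> R y \<and> u \<in> R x" if y: "y \<in> ?P" for y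
    proof -
      have "y \<noteq> x" using y zin False by blast
      then obtain u where "R y \<inter> R x = {u}" using D(6)[of y x] y x by blast
      then show ?thesis by (metis Int_iff singleton_iff)
    qed
    \<comment> \<open>A line missing \<open>z\<close> meets the \<open>q\<close> known lines through
      \<open>z\<close> in \<open>q\<close> different points; its one remaining point lies in
      \<open>A\<close>.\<close>
    define h where "h y = (THE u. u \<in> R y \<and> u \<in> R x)" for y
    have h: "h y \<in> R y" "h y \<in> R x" if "y \<in> ?P" for y
      using theI'[OF ex[OF that]] by (auto simp: h_def)
    have "inj_on h ?P"
    proof (rule inj_onI)
      fix y y' assume a: "y \<in> ?P" "y' \<in> ?P" "h y = h y'"
      then have "h y \<in> R y" "h y \<in> R y'" "h y \<noteq> z" using h False by metis+
      then show "y = y'" using uniq[of y y' "h y" z] a zin by blast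
    qed
    then have ch: "card (h ` ?P) = q" using cP by (simp add: card_image)
    have sub: "h ` ?P \<subseteq> R x" using h by blast
    have "R x \<inter> A = R x - h ` ?P"
    proof -
      have "w \<in> h ` ?P" if "w \<in> R x" "y \<in> ?P" "w \<in> R y" for w y
        using ex[OF that(2)] h[OF that(2)] that by (metis imageI)
      then show ?thesis using h False D(2)[OF x] unfolding A_def by blast
    qed
    then show ?thesis using sub ch D(3,4)[OF x] by (simp add: card_Diff_subset finite_subset)
  qed
  have sym: "x \<in> A \<longleftrightarrow> s \<in> R x" if x: "x \<in> G" for x
  proof (cases "x = z")
    case True
    then show ?thesis using zA Rz by auto
  next
    case False
    \<comment> \<open>The point common to \<open>R x\<close> and \<open>R z\<close> is either
      \<open>s\<close>, or a point of \<open>?P\<close> whose line contains \<open>x\<close> and so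
      keeps \<open>x\<close> out of \<open>A\<close>.\<close>
    then obtain u' where "R x \<inter> R z = {u'}" using D(6)[OF x z] by blast
    then obtain u where u: "u \<in> R x" "u \<in> R z" "\<And>v. v \<in> R x \<Longrightarrow> v \<in> R z \<Longrightarrow> v = u"
      by (metis Int_iff singleton_iff)
    have "x \<in> A \<longleftrightarrow> (\<forall>y\<in>?P. x \<notin> R y)" using False x D(1) by (auto simp: A_def)
    also have "\<dots> \<longleftrightarrow> (\<forall>y\<in>?P. y \<notin> R x)" using D(7) x by blast
    also have "\<dots> \<longleftrightarrow> u \<notin> ?P" using u by blast
    also have "\<dots> \<longleftrightarrow> u = s" using u Rz by blast
    also have "\<dots> \<longleftrightarrow> s \<in> R x" using u Rz by blast
    finally show ?thesis .
  qed
  have sG: "s \<notin> G" using s by blast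
  show ?thesis unfolding partial_polarity_def
  proof (intro conjI ballI impI)
    show "insert s G \<subseteq> V" using D(1) s by blast
  next
    fix x assume "x \<in> insert s G"
    then show "(R(s := A)) x \<subseteq> V" "card ((R(s := A)) x) = q + 1" using D(2,3) AV cA by auto
  next
    fix x y assume "x \<in> insert s G" "y \<in> insert s G" "x \<noteq> y"
    then show "card ((R(s := A)) x \<inter> (R(s := A)) y) = 1"
      using D(5) meet sG by (auto simp: Int_commute)
  next
    fix x y assume "x \<in> insert s G" "y \<in> insert s G"
    then show "(y \<in> (R(s := A)) x) = (x \<in> (R(s := A)) y)"
      using D(7) sym sG by auto
  qed
qed

lemma partial_polarity_extend:
  assumes "partial_polarity q V G R" and fV: "finite V" and cV: "card V = q\<^sup>2 + q + 1"
    and "card (V - G) \<le> q"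
  shows "\<exists>R'. partial_polarity q V V R' \<and> (\<forall>x\<in>G. R' x = R x)"
  using assms(1,4)
proof (induction "card (V - G)" arbitrary: G R)
  case 0
  then have "G = V" using fV partial_polarityD(1) by fastforce
  then show ?case using 0 by blast
next
  case (Suc k)
  then have "G \<noteq> V" by auto
  then obtain z s where zs: "z \<in> G" "s \<in> V - G" "R z \<inter> (V - G) = {s}"
    using exists_point_on_one_missing_line[OF Suc.prems(1) fV cV _ Suc.prems(2)] by blast
  define A where "A = {w \<in> V. w = z \<or> (\<forall>x\<in>R z \<inter> G. w \<notin> R x)}"
  have pp: "partial_polarity q V (insert s G) (R(s := A))"
    unfolding A_def by (rule partial_polarity_extend_one[OF Suc.prems(1) fV cV zs])
  have "V - insert s G = (V - G) - {s}" by blast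
  then have "card (V - insert s G) = k" using Suc.hyps(2) zs fV by simp
  then obtain R' where "partial_polarity q V V R'" "\<forall>x\<in>insert s G. R' x = (R(s := A)) x"
    using Suc.hyps(1)[OF _ pp] Suc.prems(2) Suc.hyps(2) by force
  then show ?case using zs(2) by (intro exI[of _ R']) auto
qed

text \<open>On the set \<open>H\<close> of all agreement the same point on a single missing line is
  available, and any extension has the same line there, described by \<open>char\<close>. So
  agreement spreads until \<open>H = V\<close>.\<close>

lemma partial_polarity_unique:
  assumes R1: "partial_polarity q V V R1" and R2: "partial_polarity q V V R2"
    and fV: "finite V" and cV: "card V = q\<^sup>2 + q + 1"
    and GV: "G \<subseteq> V" and le: "card (V - G) \<le> q" and eq: "\<And>x. x \<in> G \<Longrightarrow> R1 x = R2 x"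
    and x: "x \<in> V"
  shows "R1 x = R2 x"
proof -
  define H where "H = {x \<in> V. R1 x = R2 x}"
  have HV: "H \<subseteq> V" by (auto simp: H_def)
  have "H = V"
  proof (rule ccontr)
    assume ne: "H \<noteq> V"
    have "card (V - H) \<le> card (V - G)" using fV GV eq by (intro card_mono) (auto simp: H_def)
    then have le': "card (V - H) \<le> q" using le by simp
    have pp: "partial_polarity q V H R1"
      using R1 HV unfolding partial_polarity_def by blast
    obtain z s where z: "z \<in> H" "s \<in> V - H" "R1 z \<inter> (V - H) = {s}"
      using exists_point_on_one_missing_line[OF pp fV cV ne le'] by blast
    have char: "R s = {w \<in> V. w = z \<or> (\<forall>x\<in>R1 z \<inter> H. w \<notin> R1 x)}"
      if R: "partial_polarity q V V R" and Req: "\<And>x. x \<in> H \<Longrightarrow> R x = R1 x" for R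
    proof -
      note D = partial_polarityD[OF R]
      have zV: "z \<in> V" and sV: "s \<in> V" using z HV by auto
      have Rz: "R z = R1 z" using Req z by blast
      have sz: "s \<in> R z" using z Rz by blast
      then have zs: "z \<in> R s" using D(7) zV sV by blast
      have "w \<in> R s \<longleftrightarrow> (\<forall>x\<in>R1 z \<inter> H. w \<notin> R1 x)" if w: "w \<in> V" "w \<noteq> z" for w
      proof -
        obtain u' where "R w \<inter> R z = {u'}" using D(6)[of w z] w zV by blast
        then obtain u where u: "u \<in> R w" "u \<in> R z" "\<And>v. v \<in> R w \<Longrightarrow> v \<in> R z \<Longrightarrow> v = u"
          by (metis Int_iff singleton_iff)
        have "u \<in> V" using u D(2)[OF zV] by blast
        have "w \<in> R s \<longleftrightarrow> s \<in> R w" using D(7) w sV by blast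
        also have "\<dots> \<longleftrightarrow> u = s" using u sz by blast
        also have "\<dots> \<longleftrightarrow> u \<notin> R1 z \<inter> H" using u Rz z \<open>u \<in> V\<close> by blast
        also have "\<dots> \<longleftrightarrow> (\<forall>x\<in>R1 z \<inter> H. x \<notin> R w)" using u Rz by blast
        also have "\<dots> \<longleftrightarrow> (\<forall>x\<in>R1 z \<inter> H. w \<notin> R x)" using D(7) w HV by blast
        also have "\<dots> \<longleftrightarrow> (\<forall>x\<in>R1 z \<inter> H. w \<notin> R1 x)" using Req by blast
        finally show ?thesis .
      qed
      then show ?thesis using zs D(2)[OF sV] zV by blast
    qed
    have "R1 s = R2 s" using char[OF R1] char[OF R2] by (auto simp: H_def)
    then show False using z by (auto simp: H_def)
  qed
  then show ?thesis using x by (auto simp: H_def)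
qed

section \<open>Total defect below \<open>q\<close>\<close>

context c4free_rel
begin

lemma ndefect_nonneg:
  assumes "\<And>x. x \<in> V \<Longrightarrow> 0 \<le> defect x" "x \<in> V"
  shows "0 \<le> ndefect x"
  unfolding ndefect_def using assms N_in_V by (intro sum_nonneg) auto

lemma card_deficient_le:
  assumes df: "\<And>x. x \<in> V \<Longrightarrow> 0 \<le> defect x" and A: "A \<subseteq> V"
  shows "int (card (A \<inter> {x. 0 < defect x})) \<le> sum defect A"
proof -
  have fA: "finite A" using A finV finite_subset by blast
  have "int (card (A \<inter> {x. 0 < defect x})) = (\<Sum>x\<in>A. if 0 < defect x then 1 else 0)"
    using fA by (simp add: sum.If_cases)
  also have "\<dots> \<le> sum defect A" using df A by (intro sum_mono) force
  finally show ?thesis .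
qed

context
  fixes e :: real
  assumes df: "\<And>x. x \<in> V \<Longrightarrow> 0 \<le> defect x"
    and e0: "0 < e" and tot: "real_of_int total \<le> (1 - e) * real q"
    and big: "real q < e * real q * (e * real q - sqrt (real q))" and big3: "3 \<le> e * real q"
begin

lemma card_deficient_total: "int (card {x \<in> V. 0 < defect x}) \<le> total"
  using card_deficient_le[OF df, of V] by (simp add: total_def Int_def)

lemma total_le: "total + 3 \<le> int q"
proof -
  have "real_of_int (total + 3) \<le> real q" using tot big3 by (simp add: algebra_simps)
  then show ?thesis by linarith
qed

text \<open>One unlinked pair of full vertices produces a set \<open>Z\<close> of at least
  \<open>e * q\<close> full vertices, each with at least \<open>e * q\<close> deficient neighbours.
  There are at most \<open>q\<close> deficient vertices, and \<open>big\<close> is exactly what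
  makes this violate \<open>edges_between_bound\<close>.\<close>

lemma full_linked:
  assumes x: "x \<in> V" "defect x = 0" and y: "y \<in> V" "defect y = 0"
  shows "y \<notin> unlinked x"
proof
  assume yx: "y \<in> unlinked x"
  define S where "S = {x. 0 < defect x}"
  define Z where "Z = {z \<in> V. defect z = 0 \<and> (\<exists>w\<in>unlinked z. defect w = 0)}"
  have fZ: "finite Z" and ZV: "Z \<subseteq> V" using finV by (auto simp: Z_def)
  have xZ: "x \<in> Z" using x y yx by (auto simp: Z_def)
  \<comment> \<open>A full neighbour \<open>t\<close> with \<open>ndefect t = 0\<close> is linked to
    everything. The walk identity for \<open>t\<close> and \<open>w\<close> then leaves
    \<open>N t \<inter> unlinked w\<close> empty, although it contains \<open>z\<close>.\<close>
  have free: "0 < ndefect t" if z: "z \<in> Z" and t: "t \<in> N z" "defect t = 0" for z t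
  proof (rule ccontr)
    assume a: "\<not> 0 < ndefect t"
    have zV: "z \<in> V" "defect z = 0" using z by (auto simp: Z_def)
    have tV: "t \<in> V" using N_in_V zV t by blast
    obtain w where w: "w \<in> unlinked z" "defect w = 0" using z by (auto simp: Z_def)
    then have wV: "w \<in> V" using unlinked_sub by blast
    have zw: "z \<in> unlinked w" using unlinked_sym zV w by blast
    have "ndefect t = 0" using ndefect_nonneg[OF df tV] a by simp
    then have "int (card (unlinked t)) = 0" using card_unlinked[OF tV] t by simp
    then have ut: "unlinked t = {}" using fin_unlinked by simp
    have zt: "z \<in> N t" using N_sym zV t by blast
    show False
    proof (cases "t = w")
      case True
      then show False using zw ut by blast
    next
      case False
      have "int (card (N t \<inter> unlinked w)) = 0"
        using walk3_identity[OF tV wV False] ut t w by (simp split: if_splits)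
      then have "N t \<inter> unlinked w = {}" using finN[OF tV] by simp
      then show False using zt zw by blast
    qed
  qed
  have key: "int q + 1 \<le> total - (\<Sum>u\<in>unlinked z. defect u) + int (card (N z \<inter> S))" if z: "z \<in> Z" for z
  proof -
    have zV: "z \<in> V" "defect z = 0" using z by (auto simp: Z_def)
    have "int (card (N z)) = int (card (N z \<inter> S)) + int (card (N z - S))"
      using finN[OF zV(1)] card_Diff_subset_Int[of "N z" S] card_mono[of "N z" "N z \<inter> S"] by (simp add: of_nat_diff)
    moreover have "int (card (N z - S)) \<le> (\<Sum>t\<in>N z - S. ndefect t)"
    proof -
      have "1 \<le> ndefect t" if "t \<in> N z - S" for t
        using free[OF z, of t] that df[of t] N_in_V[OF zV(1), of t] by (force simp: S_def)
      then show ?thesis using sum_mono[of "N z - S" "\<lambda>_. 1" ndefect] by simp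
    qed
    moreover have "(\<Sum>t\<in>N z - S. ndefect t) \<le> (\<Sum>t\<in>N z. ndefect t)"
      using finN[OF zV(1)] ndefect_nonneg[OF df] N_in_V[OF zV(1)] by (intro sum_mono2) auto
    ultimately show ?thesis using sum_ndefect_nbrs[OF zV(1)] zV(2) by (simp add: card_N)
  qed
  have nonneg_U: "0 \<le> (\<Sum>u\<in>unlinked z. defect u)" for z
    using df unlinked_sub by (intro sum_nonneg) blast
  have SV: "card (S \<inter> V) \<le> q" and SVt: "int (card (S \<inter> V)) \<le> total"
    using card_deficient_total total_le by (auto simp: S_def Int_def conj_commute)
  \<comment> \<open>Every vertex unlinked to \<open>x\<close> is in \<open>Z\<close> or deficient,
    and their number is \<open>ndefect x\<close>, at least the number of deficient neighbours of
    \<open>x\<close>. Inserting this into \<open>key\<close> for \<open>x\<close> leaves the bound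
    on \<open>Z\<close>.\<close>
  have many: "real q + 1 - real_of_int total \<le> real (card Z)"
  proof -
    have U: "unlinked x \<subseteq> Z \<union> (unlinked x \<inter> S)"
    proof
      fix u assume u: "u \<in> unlinked x"
      then have uV: "u \<in> V" using unlinked_sub by blast
      have "x \<in> unlinked u" using u unlinked_sym x by blast
      then show "u \<in> Z \<union> (unlinked x \<inter> S)"
        using uV df[OF uV] x u unfolding Z_def S_def by force
    qed
    have "card (unlinked x) \<le> card (Z \<union> (unlinked x \<inter> S))"
      using U fZ fin_unlinked by (intro card_mono) auto
    also have "\<dots> \<le> card Z + card (unlinked x \<inter> S)" by (rule card_Un_le)
    finally have 1: "int (card (unlinked x)) \<le> int (card Z) + int (card (unlinked x \<inter> S))" by linarith
    have 2: "int (card (unlinked x \<inter> S)) \<le> (\<Sum>u\<in>unlinked x. defect u)"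
      using card_deficient_le[OF df unlinked_sub] by (simp add: S_def)
    have 3: "int (card (N x \<inter> S)) \<le> ndefect x"
      using card_deficient_le[OF df N_sub[OF x(1)]] by (simp add: S_def ndefect_def)
    have "int q + 1 - total \<le> int (card Z)"
      using 1 2 3 key[OF xZ] card_unlinked[OF x(1)] x(2) by simp
    then show ?thesis by linarith
  qed
  have "real (card Z) * (e * real q) \<le> (\<Sum>z\<in>Z. real (card (N z \<inter> (S \<inter> V))))"
  proof -
    have "e * real q \<le> real (card (N z \<inter> (S \<inter> V)))" if z: "z \<in> Z" for z
    proof -
      have "N z \<inter> (S \<inter> V) = N z \<inter> S" using N_sub[of z] z by (auto simp: Z_def)
      moreover have "int q + 1 \<le> total + int (card (N z \<inter> S))" using key[OF z] nonneg_U[of z] by simp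
      ultimately show ?thesis using tot by (simp add: algebra_simps)
    qed
    then show ?thesis using sum_mono[of Z "\<lambda>_. e * real q"] by simp
  qed
  also have "\<dots> = real (\<Sum>z\<in>Z. card (N z \<inter> (S \<inter> V)))" by simp
  also have "\<dots> \<le> real (card (S \<inter> V)) + real (card Z) * sqrt (real (card (S \<inter> V)))"
    by (rule edges_between_bound) (use ZV in auto)
  also have "\<dots> \<le> real q + real (card Z) * sqrt (real q)"
    using SV by (intro add_mono mult_left_mono) auto
  finally have 4: "real (card Z) * (e * real q - sqrt (real q)) \<le> real q" by (simp add: algebra_simps)
  have 5: "0 < e * real q - sqrt (real q)"
  proof (rule ccontr)
    assume "\<not> ?thesis"
    then have "e * real q * (e * real q - sqrt (real q)) \<le> 0" using e0 by (intro mult_nonneg_nonpos) auto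
    then show False using big by simp
  qed
  have "e * real q \<le> real (card Z)" using many tot by (simp add: algebra_simps)
  then have "e * real q * (e * real q - sqrt (real q)) \<le> real (card Z) * (e * real q - sqrt (real q))"
    using 5 by (intro mult_right_mono) auto
  then show False using 4 big by linarith
qed

lemma card_V_minus_full: "card (V - {x \<in> V. defect x = 0}) \<le> q"
proof -
  have "V - {x \<in> V. defect x = 0} = {x \<in> V. 0 < defect x}" using df by force
  then show ?thesis using card_deficient_total total_le by simp
qed

text \<open>The full vertices form a partial polarity, so only edges between two deficient vertices
  \<open>s\<close> and \<open>t\<close> could be lost in the completion. At a lost edge the full
  neighbours of \<open>t\<close> inject into the points of \<open>R s\<close> not attained by
  \<open>N s\<close>. Thus \<open>s\<close> and \<open>t\<close> have at most \<open>q + 1\<close>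
  full neighbours together, and a total defect of at most \<open>q - 3\<close> cannot pay for
  that.\<close>

lemma exists_polarity_above:
  "\<exists>R. partial_polarity q V V R \<and> (\<forall>x\<in>V. \<forall>y\<in>N x. y \<noteq> x \<longrightarrow> y \<in> R x)"
proof -
  define F where "F = {x \<in> V. defect x = 0}"
  have FV: "F \<subseteq> V" by (auto simp: F_def)
  have pp: "partial_polarity q V F N"
    unfolding partial_polarity_def
  proof (intro conjI ballI impI)
    fix x assume "x \<in> F"
    then show "N x \<subseteq> V" "card (N x) = q + 1" using N_sub card_N[of x] by (auto simp: F_def)
  next
    fix x y assume "x \<in> F" "y \<in> F" "x \<noteq> y"
    then show "card (N x \<inter> N y) = 1"
      using card_common[of x y] full_linked[of y x] by (auto simp: F_def)
  next
    fix x y assume "x \<in> F" "y \<in> F"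
    then show "y \<in> N x \<longleftrightarrow> x \<in> N y" using N_sym_iff by (auto simp: F_def)
  qed (fact FV)
  obtain R where R: "partial_polarity q V V R" and RN: "\<And>x. x \<in> F \<Longrightarrow> R x = N x"
    using partial_polarity_extend[OF pp finV cardV] card_V_minus_full by (auto simp: F_def)
  note D = partial_polarityD[OF R]
  have "t \<in> R s" if s: "s \<in> V" and t: "t \<in> N s" and ne: "t \<noteq> s" for s t
  proof (rule ccontr)
    assume nR: "t \<notin> R s"
    have tV: "t \<in> V" using N_in_V s t .
    have st: "s \<in> N t" using N_sym s t .
    have sF: "s \<notin> F" using RN t nR by blast
    have tF: "t \<notin> F" using RN[of t] st nR D(7)[of t s] s tV by blast
    \<comment> \<open>The lines of \<open>p\<close> and \<open>s\<close> meet; were the meeting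
      point in \<open>N s\<close>, then \<open>p\<close> and \<open>s\<close> would have it and
      \<open>t\<close> as common neighbours.\<close>
    have ex: "\<exists>u. u \<in> N p \<and> u \<in> R s - N s" if p: "p \<in> N t \<inter> F" for p
    proof -
      have pV: "p \<in> V" using p FV by blast
      have ps: "p \<noteq> s" using p sF by blast
      obtain u where "R p \<inter> R s = {u}" using D(6)[OF pV s ps] by blast
      then have u: "u \<in> N p" "u \<in> R s" using RN p by auto
      have "u \<notin> N s"
      proof
        assume "u \<in> N s"
        moreover have "t \<in> N p" using p N_sym tV by blast
        ultimately have "u = t" using codeg[OF pV s ps u(1) _ _ t] by blast
        then show False using u nR by blast
      qed
      then show ?thesis using u by blast
    qed
    define h where "h p = (SOME u. u \<in> N p \<and> u \<in> R s - N s)" for p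
    have h: "h p \<in> N p" "h p \<in> R s - N s" if "p \<in> N t \<inter> F" for p
      using someI_ex[OF ex[OF that]] by (auto simp: h_def)
    have sub: "N s \<inter> F \<subseteq> R s" using RN N_sym s D(7) FV by blast
    have "inj_on h (N t \<inter> F)"
    proof (rule inj_onI, rule ccontr)
      fix p p' assume a: "p \<in> N t \<inter> F" "p' \<in> N t \<inter> F" "h p = h p'" "p \<noteq> p'"
      have "t \<in> N p" "t \<in> N p'" using a N_sym tV by blast+
      then have "h p = t" using codeg[of p p' "h p" t] a h FV by (metis IntD2 subsetD)
      then show False using h(2)[OF a(1)] nR by blast
    qed
    moreover have fR: "finite (R s)" using D(4) s by blast
    ultimately have "card (N t \<inter> F) \<le> card (R s - N s)"
      using h by (intro card_inj_on_le[of h]) auto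
    also have "\<dots> \<le> card (R s - (N s \<inter> F))" using fR by (intro card_mono) auto
    also have "\<dots> = card (R s) - card (N s \<inter> F)"
      using finN s sub by (intro card_Diff_subset) auto
    also have "card (R s) = q + 1" using D(3) s .
    finally have le: "card (N t \<inter> F) + card (N s \<inter> F) \<le> q + 1"
      using card_mono[OF fR sub] D(3)[OF s] by linarith
    define S where "S = {x \<in> V. 0 < defect x}"
    have fS: "finite S" using finV by (simp add: S_def)
    have split: "card (N x) = card (N x \<inter> F) + card (N x \<inter> S)" if x: "x \<in> V" for x
    proof -
      have "N x = (N x \<inter> F) \<union> (N x \<inter> S)"
        using N_sub[OF x] df unfolding F_def S_def by force
      moreover have "(N x \<inter> F) \<inter> (N x \<inter> S) = {}" by (auto simp: F_def S_def)
      ultimately show ?thesis using card_Un_disjoint[of "N x \<inter> F" "N x \<inter> S"] finN[OF x] by simp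
    qed
    have "card (N s \<inter> S) + card (N t \<inter> S)
        = card (N s \<inter> S \<union> N t \<inter> S) + card ((N s \<inter> S) \<inter> (N t \<inter> S))"
      using finN s tV by (intro card_Un_Int) auto
    also have "\<dots> \<le> card S + card (N s \<inter> N t)"
      using fS finN s by (intro add_mono card_mono) auto
    also have "\<dots> \<le> card S + 1" using codeg_le[OF s tV] ne by simp
    finally have b: "card (N s \<inter> S) + card (N t \<inter> S) \<le> card S + 1" .
    have sS: "s \<in> S" "t \<in> S" using s tV sF tF df[of s] df[of t] by (auto simp: F_def S_def)
    have "defect s + defect t + int (card (S - {s, t})) \<le> sum defect S"
    proof -
      have "int (card (S - {s, t})) \<le> sum defect (S - {s, t})"
        using sum_mono[of "S - {s, t}" "\<lambda>_. 1" defect] by (force simp: S_def)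
      moreover have "sum defect S = sum defect {s, t} + sum defect (S - {s, t})"
        using sS fS sum.subset_diff[of "{s, t}" S defect] by simp
      ultimately show ?thesis using ne by simp
    qed
    moreover have "card (S - {s, t}) = card S - 2" using sS ne fS by (subst card_Diff_subset) auto
    moreover have "sum defect S \<le> total"
      unfolding total_def using finV df by (intro sum_mono2) (auto simp: S_def)
    ultimately have "defect s + defect t + int (card S) \<le> total + 2" by linarith
    then show False using total_le b le split[OF s] split[OF tV] card_N[of s] card_N[of t] by linarith
  qed
  then show ?thesis using R by blast
qed

end

end

section \<open>Dictionary between polarity graphs and symmetric incidence relations\<close>

definition rel_edges :: "'a set \<Rightarrow> ('a \<Rightarrow> 'a set) \<Rightarrow> 'a set set" where
  "rel_edges V R = {{x, y} | x y. x \<in> V \<and> y \<in> V \<and> x \<noteq> y \<and> x \<in> R y}"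

lemma polarity_graph_of_partial_polarity:
  assumes R: "partial_polarity q V V R" and cV: "card V = q\<^sup>2 + q + 1" and q: "0 < q"
  shows "polarity_graph q V (rel_edges V R)"
proof -
  note D = partial_polarityD[OF R]
  \<comment> \<open>Equal lines of distinct points would meet in a single point and so have size 1;
    here \<open>0 < q\<close> is used.\<close>
  have inj: "inj_on R V"
  proof (rule inj_onI, rule ccontr)
    fix x y assume a: "x \<in> V" "y \<in> V" "R x = R y" "x \<noteq> y"
    then have "card (R x) = 1" using D(5)[of x y] by simp
    then show False using D(3)[of x] a q by simp
  qed
  define \<pi> where "\<pi> = case_sum (\<lambda>x. Inr (R x)) (\<lambda>l. Inl (the_inv_into V R l))"
  have inv: "the_inv_into V R (R x) = x" if "x \<in> V" for x
    using the_inv_into_f_f[OF inj that] .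
  have pl: "projective_plane q V (R ` V)"
    unfolding projective_plane_def
  proof (intro conjI ballI impI)
    fix x assume x: "x \<in> V"
    have "{l \<in> R ` V. x \<in> l} = R ` R x" using D(2,7) x by (auto 4 4)
    moreover have "inj_on R (R x)" using inj_on_subset[OF inj] D(2) x by blast
    ultimately show "card {l \<in> R ` V. x \<in> l} = q + 1" using D(3) x by (simp add: card_image)
  next
    fix l m assume "l \<in> R ` V" "m \<in> R ` V" "l \<noteq> m"
    then show "card (l \<inter> m) = 1" using D(5) by blast
  qed (use D(2,3) cV in auto)
  have inv2: "\<pi> (\<pi> z) = z" if "z \<in> V <+> R ` V" for z
    using that by (auto simp: \<pi>_def inv)
  have mem: "\<pi> z \<in> V <+> R ` V" if "z \<in> V <+> R ` V" for z
    using that by (auto simp: \<pi>_def inv)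
  have pol: "polarity V (R ` V) \<pi>"
    unfolding polarity_def
  proof (intro conjI ballI impI)
    show "bij_betw \<pi> (V <+> R ` V) (V <+> R ` V)"
      by (rule bij_betw_byWitness[where f' = \<pi>]) (use inv2 mem in auto)
    show "\<pi> ` Inl ` V = Inr ` R ` V" by (auto simp: \<pi>_def image_image)
    show "\<pi> ` Inr ` R ` V = Inl ` V" by (auto simp: \<pi>_def image_image inv)
  next
    fix x l assume "x \<in> V" "l \<in> R ` V" "x \<in> l"
    then show "projl (\<pi> (Inr l)) \<in> projr (\<pi> (Inl x))" using D(7) by (auto simp: \<pi>_def inv)
  qed (fact inv2)
  have "rel_edges V R = polarity_graph_edges V \<pi>"
    by (simp add: rel_edges_def polarity_graph_edges_def \<pi>_def)
  then show ?thesis using pl pol unfolding polarity_graph_def by blast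
qed

lemma polarity_graph_imp_partial_polarity:
  assumes "polarity_graph q V F"
  obtains R where "partial_polarity q V V R" "F = rel_edges V R"
proof -
  obtain L \<pi> where pl: "projective_plane q V L" and pol: "polarity V L \<pi>" and F: "F = polarity_graph_edges V \<pi>"
    using assms unfolding polarity_graph_def by blast
  define R where "R x = projr (\<pi> (Inl x))" for x
  have R: "\<pi> (Inl x) = Inr (R x)" "R x \<in> L" if "x \<in> V" for x
  proof -
    have "\<pi> (Inl x) \<in> Inr ` L" using pol that unfolding polarity_def by blast
    then show "\<pi> (Inl x) = Inr (R x)" "R x \<in> L" by (auto simp: R_def)
  qed
  have inv: "\<pi> (Inr (R x)) = Inl x" if "x \<in> V" for x
    using pol R(1)[OF that] that unfolding polarity_def by (metis InlI)
  have inj: "x = y" if "x \<in> V" "y \<in> V" "R x = R y" for x y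
    using inv that by (metis Inl_inject)
  have "partial_polarity q V V R"
    unfolding partial_polarity_def
  proof (intro conjI ballI impI)
    fix x assume "x \<in> V"
    then show "R x \<subseteq> V" "card (R x) = q + 1" using pl R unfolding projective_plane_def by blast+
  next
    fix x y assume "x \<in> V" "y \<in> V" "x \<noteq> y"
    then show "card (R x \<inter> R y) = 1" using pl R inj unfolding projective_plane_def by metis
  next
    have "y \<in> R x" if "x \<in> V" "y \<in> V" "x \<in> R y" for x y
      using pol that R(2)[of y] inv[of y] unfolding polarity_def R_def[of x, symmetric] by (metis R_def sum.sel(1))
    then show "y \<in> R x \<longleftrightarrow> x \<in> R y" if "x \<in> V" "y \<in> V" for x y using that by blast
  qed simp
  moreover have "F = rel_edges V R" unfolding F polarity_graph_edges_def rel_edges_def R_def ..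
  ultimately show thesis using that by blast
qed

section \<open>Vertices of full degree in a graph of even order\<close>

lemma even_card_involution:
  assumes "finite A" "\<And>x. x \<in> A \<Longrightarrow> f x \<in> A \<and> f x \<noteq> x \<and> f (f x) = x"
  shows "even (card A)"
  using assms
proof (induction "card A" arbitrary: A rule: less_induct)
  case less
  show ?case
  proof (cases "A = {}")
    case False
    then obtain x where x: "x \<in> A" by blast
    have f: "f x \<in> A" "f x \<noteq> x" using less.prems(2) x by blast+
    let ?B = "A - {x, f x}"
    have c: "card A = card ?B + 2"
      using card_Diff_subset[of "{x, f x}" A] card_mono[of A "{x, f x}"] x f less.prems(1) by simp
    have "even (card ?B)"
    proof (rule less.hyps)
      fix y assume "y \<in> ?B"
      then show "f y \<in> ?B \<and> f y \<noteq> y \<and> f (f y) = y"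
        using less.prems(2) x by (metis DiffE DiffI insertCI insertE singletonD)
    qed (use c less.prems(1) in auto)
    then show ?thesis using c by simp
  qed simp
qed

locale c4free_graph = c4free_rel +
  assumes loopless: "x \<in> V \<Longrightarrow> x \<notin> N x"
    and defect_nonneg: "x \<in> V \<Longrightarrow> 0 \<le> defect x"
    and even_q: "even q"
    and total_less: "total + 2 \<le> 2 * int q"
begin

definition full :: "'a set" where "full = {x \<in> V. defect x = 0}"
definition deficient :: "'a set" where "deficient = {x \<in> V. 0 < defect x}"

text \<open>By parity \<open>ndefect\<close> is at least 1 on full vertices, and the bound on
  \<open>total\<close> keeps its average near a full vertex below 2. So value 1, meaning a single
  unlinked vertex, is the typical case, and \<open>far\<close> collects the full vertices that see
  none of it.\<close>

definition full1 :: "'a set" where "full1 = {x \<in> full. ndefect x = 1}"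
definition far :: "'a set" where "far = {u \<in> full. N u \<inter> full1 = {}}"

text \<open>Since there are no loops, an edge whose ends are unlinked is an edge in no
  triangle.\<close>

definition loose :: "'a \<Rightarrow> 'a set" where "loose u = full \<inter> N u \<inter> unlinked u"

lemma fullD: "x \<in> full \<Longrightarrow> x \<in> V" "x \<in> full \<Longrightarrow> defect x = 0"
  by (auto simp: full_def)

lemma full1D: "x \<in> full1 \<Longrightarrow> x \<in> full" "x \<in> full1 \<Longrightarrow> ndefect x = 1"
  by (auto simp: full1_def)

lemma fin_full: "finite full" and fin_deficient: "finite deficient"
  using finV by (auto simp: full_def deficient_def)

lemma V_split: "V = full \<union> deficient" "full \<inter> deficient = {}"
  using defect_nonneg by (force simp: full_def deficient_def)+

lemma card_nbrs_split:
  assumes x: "x \<in> V"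
  shows "card (N x) = card (N x \<inter> full) + card (N x \<inter> deficient)"
proof -
  have "N x = (N x \<inter> full) \<union> (N x \<inter> deficient)" using N_sub[OF x] V_split by blast
  then show ?thesis
    using card_Un_disjoint[of "N x \<inter> full" "N x \<inter> deficient"] V_split(2) finN[OF x] by (metis finite_Int Int_empty_right inf.left_commute inf_assoc)
qed

lemma card_nbrs_deficient_le:
  assumes x: "x \<in> V"
  shows "int (card (N x \<inter> deficient)) \<le> ndefect x"
proof -
  have "N x \<inter> deficient = N x \<inter> {x. 0 < defect x}" using N_sub[OF x] by (auto simp: deficient_def)
  then show ?thesis using card_deficient_le[OF defect_nonneg N_sub[OF x]] by (simp add: ndefect_def)
qed

lemma ndefect_ge_0: "x \<in> V \<Longrightarrow> 0 \<le> ndefect x"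
  using ndefect_nonneg defect_nonneg by blast

text \<open>An edge lies in at most one triangle, so the triangles through \<open>x\<close> pair off
  the neighbours involved.\<close>

lemma even_card_triangle_nbrs:
  assumes x: "x \<in> V"
  shows "even (card (N x - unlinked x))"
proof -
  have ex: "\<exists>!z. z \<in> N x \<inter> N y" if y: "y \<in> N x - unlinked x" for y
  proof -
    have yV: "y \<in> V" "y \<noteq> x" using y N_in_V x loopless by blast+
    then have "N x \<inter> N y \<noteq> {}" using y by (auto simp: unlinked_def)
    then show ?thesis using codeg[OF x yV(1)] yV(2) by blast
  qed
  define f where "f y = (THE z. z \<in> N x \<inter> N y)" for y
  have f: "f y \<in> N x" "f y \<in> N y" if "y \<in> N x - unlinked x" for y
    using theI'[OF ex[OF that]] by (auto simp: f_def)
  show ?thesis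
  proof (rule even_card_involution[of _ f])
    fix y assume y: "y \<in> N x - unlinked x"
    have V: "y \<in> V" "f y \<in> V" using y f N_in_V x by blast+
    have a: "y \<in> N (f y)" using N_sym f[OF y] V by blast
    then have b: "f y \<in> N x - unlinked x" using f[OF y] y unlinked_no_common by blast
    have "f (f y) = y" using ex[OF b] f[OF b] a y by blast
    then show "f y \<in> N x - unlinked x \<and> f y \<noteq> y \<and> f (f y) = y"
      using b f[OF y] V loopless by metis
  qed (use finN x in auto)
qed

lemma full_has_triangle_free_nbr:
  assumes x: "x \<in> full"
  obtains y where "y \<in> N x" "y \<in> unlinked x"
proof -
  have "int (card (N x)) = int q + 1" using x by (simp add: full_def card_N)
  then have "odd (card (N x))" using even_q by presburger
  then have "N x - unlinked x \<noteq> N x" using even_card_triangle_nbrs fullD(1)[OF x] by metis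
  then show thesis using that by blast
qed

lemma card_unlinked_full: "x \<in> full \<Longrightarrow> int (card (unlinked x)) = ndefect x"
  using card_unlinked by (simp add: full_def)

lemma ndefect_full_ge_1:
  assumes "x \<in> full"
  shows "1 \<le> ndefect x"
proof -
  obtain y where "y \<in> unlinked x" using full_has_triangle_free_nbr assms by blast
  then have "card (unlinked x) \<noteq> 0" using fin_unlinked by auto
  then show ?thesis using card_unlinked_full assms by fastforce
qed

lemma full1_unlinked:
  assumes "x \<in> full1"
  obtains y where "y \<in> N x" "unlinked x = {y}"
proof -
  have "card (unlinked x) = 1" using card_unlinked_full full1D assms by fastforce
  then show thesis
    using that full_has_triangle_free_nbr full1D(1)[OF assms] by (metis card_1_singletonE singletonD)
qed

text \<open>\<open>ndefect\<close> is at least 1 at each full neighbour, at least 2 outside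
  \<open>full1\<close>, and sums to at most \<open>total\<close>.\<close>

lemma twice_full_nbrs_le:
  assumes u: "u \<in> full"
  shows "2 * int (card (N u \<inter> full)) \<le> total + int (card (N u \<inter> full1))"
proof -
  have uV: "u \<in> V" "defect u = 0" using u fullD by blast+
  have f: "finite (N u)" using finN uV by blast
  have "2 * int (card (N u \<inter> full)) - int (card (N u \<inter> full1))
      = (\<Sum>t\<in>N u \<inter> full. 2 - (if t \<in> full1 then 1 else 0))"
  proof -
    have "(N u \<inter> full) \<inter> {t. t \<in> full1} = N u \<inter> full1" by (auto simp: full1_def)
    then show ?thesis using f by (simp add: sum_subtractf sum.If_cases)
  qed
  also have "\<dots> \<le> (\<Sum>t\<in>N u \<inter> full. ndefect t)"
  proof (rule sum_mono)
    fix t assume "t \<in> N u \<inter> full"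
    then show "2 - (if t \<in> full1 then 1 else 0) \<le> ndefect t"
      using ndefect_full_ge_1[of t] by (auto simp: full1_def)
  qed
  also have "\<dots> \<le> (\<Sum>t\<in>N u. ndefect t)"
    using f ndefect_ge_0 N_in_V uV by (intro sum_mono2) auto
  also have "\<dots> \<le> total"
    using sum_ndefect_nbrs[OF uV(1)] uV(2) defect_nonneg unlinked_sub
    by (simp add: sum_nonneg subset_iff)
  finally show ?thesis by simp
qed

text \<open>At most one neighbour is deficient, so \<open>q\<close> are full, and
  \<open>2 * q\<close> exceeds \<open>total\<close> by at least 2. Two such neighbours are wanted
  because the next argument has to avoid one given vertex.\<close>

lemma full1_nbrs_full1:
  assumes x: "x \<in> full1"
  shows "2 \<le> card (N x \<inter> full1)"
proof -
  have xF: "x \<in> full" "x \<in> V" using x full1D fullD by blast+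
  have "int (card (N x)) = int q + 1" using xF by (simp add: full_def card_N)
  moreover have "int (card (N x \<inter> deficient)) \<le> 1"
    using card_nbrs_deficient_le[of x] xF full1D(2)[OF x] by simp
  ultimately have "int q \<le> int (card (N x \<inter> full))" using card_nbrs_split[OF xF(2)] by linarith
  then show ?thesis using twice_full_nbrs_le[OF xF(1)] total_less by linarith
qed

text \<open>If \<open>y\<close> were full, take a neighbour \<open>x'\<close> of \<open>x\<close> in
  \<open>full1\<close> other than \<open>y\<close>. The walk identity for \<open>x'\<close> and
  \<open>y\<close> places the only vertex \<open>y'\<close> unlinked to \<open>x'\<close> in
  \<open>N y\<close>, which closes the 4-cycle \<open>x\<close>, \<open>x'\<close>,
  \<open>y'\<close>, \<open>y\<close>.\<close>

lemma full1_unlinked_deficient: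
  assumes x: "x \<in> full1" and y: "y \<in> unlinked x"
  shows "y \<in> deficient"
proof (rule ccontr)
  assume yS: "y \<notin> deficient"
  have xF: "x \<in> full" "x \<in> V" using x full1D fullD by blast+
  have yV: "y \<in> V" using y unlinked_sub by blast
  then have yF: "y \<in> full" using yS V_split by blast
  have Ux: "unlinked x = {y}" "y \<in> N x" using full1_unlinked[OF x] y by (metis singletonD)+
  have "\<not> N x \<inter> full1 \<subseteq> {y}" using full1_nbrs_full1[OF x] card_mono[of "{y}" "N x \<inter> full1"] by auto
  then obtain x' where x': "x' \<in> N x" "x' \<in> full1" "x' \<noteq> y" by blast
  have x'F: "x' \<in> full" "x' \<in> V" using x' full1D fullD by blast+
  obtain y' where y': "y' \<in> N x'" "unlinked x' = {y'}" using full1_unlinked[OF x'(2)] .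
  have xx': "x \<in> N x'" and xy: "x \<in> N y" using N_sym xF x' Ux by blast+
  have "y \<notin> N x'" using unlinked_no_common[OF y x'(1)] N_sym x'F by blast
  then have "int (card (N x' \<inter> unlinked y)) = int (card (N y \<inter> unlinked x'))"
    using walk3_identity[OF x'F(2) yV x'(3)] x'F yF by (simp add: full_def)
  moreover have "x \<in> N x' \<inter> unlinked y" using xx' unlinked_sym[OF xF(2) y] by blast
  then have "card (N x' \<inter> unlinked y) \<noteq> 0" using finN[OF x'F(2)] by auto
  ultimately have "N y \<inter> unlinked x' \<noteq> {}" by force
  then have y'y: "y' \<in> N y" using y' by auto
  have "y' \<noteq> x"
  proof
    assume "y' = x"
    then have "x' \<in> unlinked x" using y' unlinked_sym[OF x'F(2)] by blast
    then show False using Ux x'(3) by blast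
  qed
  then show False using codeg[OF x'F(2) yV x'(3) y'(1) y'y xx' xy] by blast
qed

text \<open>If \<open>u\<close> were full with a neighbour \<open>y\<close> in \<open>full1\<close>,
  the walk identity for \<open>y\<close> and \<open>t\<close> would make the deficient vertex
  unlinked to \<open>y\<close> a common neighbour of \<open>y\<close> and \<open>t\<close>; but
  \<open>u\<close> already is one.\<close>

lemma loose_nbr_cases:
  assumes t: "t \<in> full" and u: "u \<in> N t" "u \<in> unlinked t"
  shows "u \<in> deficient \<or> u \<in> far"
proof (rule ccontr)
  assume a: "\<not> ?thesis"
  have tV: "t \<in> V" using t fullD by blast
  have uV: "u \<in> V" using N_in_V tV u by blast
  have uF: "u \<in> full" using a uV V_split by blast
  then obtain y where y: "y \<in> N u" "y \<in> full1" using a by (auto simp: far_def)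
  have yF: "y \<in> full" "y \<in> V" using y full1D fullD by blast+
  have yt: "y \<noteq> t" using full1_unlinked_deficient[of t u] y u a by blast
  have uy: "u \<in> N y" using N_sym uV y by blast
  have "t \<notin> N y"
    using unlinked_no_common[OF u(2) _ y(1)] N_sym[OF yF(2)] by blast
  then have "int (card (N y \<inter> unlinked t)) = int (card (N t \<inter> unlinked y))"
    using walk3_identity[OF yF(2) tV yt] yF t by (simp add: full_def)
  moreover have "card (N y \<inter> unlinked t) \<noteq> 0" using u uy finN[OF yF(2)] by auto
  ultimately have "N t \<inter> unlinked y \<noteq> {}" by force
  then obtain w where w: "w \<in> N t" "w \<in> unlinked y" by blast
  have "w \<in> deficient" using full1_unlinked_deficient y w by blast
  moreover have "w \<in> N y" using full1_unlinked[OF y(2)] w by (metis singletonD)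
  then have "u = w" using codeg[OF yF(2) tV yt uy u(1)] w by blast
  ultimately show False using a by blast
qed

lemma far_deficient_nbrs:
  assumes u: "u \<in> far"
  shows "2 * (int q + 1) \<le> total + 2 * int (card (N u \<inter> deficient))"
proof -
  have uF: "u \<in> full" "u \<in> V" "N u \<inter> full1 = {}" using u fullD by (auto simp: far_def)
  have "int (card (N u)) = int q + 1" using uF by (simp add: full_def card_N)
  then show ?thesis using twice_full_nbrs_le[OF uF(1)] card_nbrs_split[OF uF(2)] uF(3) by simp
qed

lemma loose_sub: "loose u \<subseteq> full" "loose u \<subseteq> N u" "loose u \<subseteq> unlinked u"
  by (auto simp: loose_def)

lemma fin_loose: "finite (loose u)"
  using loose_sub fin_full finite_subset by blast

lemma card_full_le_sum_loose:
  "card full \<le> (\<Sum>u\<in>deficient. card (loose u)) + card far * (q + 1)"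
proof -
  have farV: "far \<subseteq> V" "finite far" using fin_full fullD finite_subset[of far full] by (auto simp: far_def)
  have "full \<subseteq> (\<Union>u\<in>deficient. loose u) \<union> (\<Union>u\<in>far. N u)"
  proof
    fix t assume t: "t \<in> full"
    obtain u where u: "u \<in> N t" "u \<in> unlinked t" using full_has_triangle_free_nbr[OF t] .
    have tV: "t \<in> V" using t fullD by blast
    have "t \<in> N u" "t \<in> unlinked u" using u N_sym tV unlinked_sym by blast+
    then show "t \<in> (\<Union>u\<in>deficient. loose u) \<union> (\<Union>u\<in>far. N u)"
      using loose_nbr_cases[OF t u] t by (auto simp: loose_def)
  qed
  then have "card full \<le> card ((\<Union>u\<in>deficient. loose u) \<union> (\<Union>u\<in>far. N u))"
    using farV fin_deficient fin_loose finN by (intro card_mono) auto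
  also have "\<dots> \<le> card (\<Union>u\<in>deficient. loose u) + card (\<Union>u\<in>far. N u)" by (rule card_Un_le)
  also have "\<dots> \<le> (\<Sum>u\<in>deficient. card (loose u)) + (\<Sum>u\<in>far. card (N u))"
    using farV fin_deficient by (intro add_mono card_UN_le) auto
  also have "(\<Sum>u\<in>far. card (N u)) = (\<Sum>u\<in>far. q + 1)"
  proof (rule sum.cong[OF refl])
    fix u assume "u \<in> far"
    then show "card (N u) = q + 1" using card_N[of u] by (simp add: far_def full_def)
  qed
  finally show ?thesis by simp
qed

text \<open>Let \<open>t\<close> be in \<open>loose u\<close>. In the walk identity for
  \<open>t\<close> and \<open>r\<close> the vertex \<open>u\<close> counts on the side of
  \<open>r\<close>, so \<open>N t\<close> contains at least \<open>1 + defect r\<close> vertices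
  unlinked to \<open>r\<close>. For different \<open>t\<close> these are disjoint, as
  \<open>u\<close> is the only common neighbour, and the right-hand side is the size of
  \<open>unlinked r\<close>.\<close>

lemma triangle_nbr_ndefect:
  assumes u: "u \<in> V" and r: "r \<in> N u" "r \<notin> unlinked u"
  shows "(1 + defect r) * int (card (loose u)) \<le> int q * defect r + ndefect r"
proof -
  have rV: "r \<in> V" using N_in_V u r by blast
  have ur: "u \<in> N r" using N_sym u r by blast
  have big: "1 + defect r \<le> int (card (N t \<inter> unlinked r))" if t: "t \<in> loose u" for t
  proof -
    have t': "t \<in> full" "t \<in> V" "t \<in> N u" "t \<in> unlinked u" using t fullD by (auto simp: loose_def)
    have tr: "t \<noteq> r" using t' r by blast
    have "r \<notin> N t" using unlinked_no_common[OF t'(4) r(1)] by blast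
    moreover have "u \<in> N r \<inter> unlinked t" using ur unlinked_sym u t' by blast
    then have "card (N r \<inter> unlinked t) \<noteq> 0" using finN[OF rV] by auto
    ultimately show ?thesis using walk3_identity[OF t'(2) rV tr] t' by (simp add: full_def)
  qed
  have "(1 + defect r) * int (card (loose u)) = (\<Sum>t\<in>loose u. 1 + defect r)" by simp
  also have "\<dots> \<le> (\<Sum>t\<in>loose u. int (card (N t \<inter> unlinked r)))" using big by (rule sum_mono)
  also have "\<dots> = int (card (\<Union>t\<in>loose u. N t \<inter> unlinked r))"
  proof -
    have "(N t \<inter> unlinked r) \<inter> (N t' \<inter> unlinked r) = {}"
      if t: "t \<in> loose u" "t' \<in> loose u" "t \<noteq> t'" for t t'
    proof -
      have tV: "t \<in> V" "t' \<in> V" "u \<in> N t" "u \<in> N t'"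
        using t fullD loose_sub N_sym[OF u] by blast+
      have "u \<notin> unlinked r" using r unlinked_sym rV by blast
      then show ?thesis using codeg[OF tV(1,2) t(3) _ _ tV(3,4)] by blast
    qed
    then show ?thesis
      using fin_loose fin_unlinked by (subst card_UN_disjoint) auto
  qed
  also have "\<dots> \<le> int (card (unlinked r))" using fin_unlinked by (intro of_nat_mono card_mono) auto
  also have "\<dots> = int q * defect r + ndefect r" by (rule card_unlinked[OF rV])
  finally show ?thesis .
qed

definition tight :: "'a \<Rightarrow> 'a set" where "tight u = N u \<inter> full - unlinked u"

text \<open>Each full neighbour in a triangle with \<open>u\<close> has \<open>ndefect\<close> at
  least \<open>card (loose u)\<close>, paid from the budget of \<open>N u\<close>. A vertex with
  many loose edges thus has few triangles.\<close>

lemma card_tight_bound: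
  assumes u: "u \<in> V"
  shows "int (card (tight u)) * int (card (loose u)) \<le> total + int q * defect u"
proof -
  have f: "finite (N u)" using finN u .
  have "int (card (tight u)) * int (card (loose u)) = (\<Sum>r\<in>tight u. int (card (loose u)))" by simp
  also have "\<dots> \<le> (\<Sum>r\<in>tight u. ndefect r)"
  proof (rule sum_mono)
    fix r assume "r \<in> tight u"
    then show "int (card (loose u)) \<le> ndefect r"
      using triangle_nbr_ndefect[OF u, of r] by (auto simp: tight_def full_def)
  qed
  also have "\<dots> \<le> (\<Sum>r\<in>N u. ndefect r)"
    using f ndefect_ge_0 N_in_V u by (intro sum_mono2) (auto simp: tight_def)
  also have "\<dots> \<le> total + defect u * (int q - defect u)"
    using sum_ndefect_nbrs[OF u] defect_nonneg unlinked_sub by (simp add: sum_nonneg subset_iff)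
  also have "\<dots> \<le> total + int q * defect u" using defect_nonneg[OF u] by (simp add: algebra_simps)
  finally show ?thesis .
qed

lemma degree_split:
  assumes u: "u \<in> V"
  shows "int q + 1 = defect u + int (card (loose u)) + int (card (tight u)) + int (card (N u \<inter> deficient))"
proof -
  have "N u \<inter> full = loose u \<union> tight u" "loose u \<inter> tight u = {}" by (auto simp: loose_def tight_def)
  then have "card (N u \<inter> full) = card (loose u) + card (tight u)"
    using card_Un_disjoint[of "loose u" "tight u"] fin_loose finN[OF u] by (auto simp: tight_def)
  then show ?thesis using card_nbrs_split[OF u] card_N[of u] by simp
qed

end

section \<open>Many absolute points\<close>

context c4free_graph
begin

lemma ndefect_add_le:
  assumes r: "r \<in> V" "r' \<in> V"
  shows "ndefect r + ndefect r' \<le> total + (\<Sum>u\<in>N r \<inter> N r'. defect u)"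
proof -
  have "ndefect r + ndefect r' = (\<Sum>u\<in>N r \<union> N r'. defect u) + (\<Sum>u\<in>N r \<inter> N r'. defect u)"
    unfolding ndefect_def using finN r by (intro sum.union_inter[symmetric]) auto
  moreover have "(\<Sum>u\<in>N r \<union> N r'. defect u) \<le> total"
    unfolding total_def using finV N_sub r defect_nonneg by (intro sum_mono2) auto
  ultimately show ?thesis by simp
qed

lemma card_N_le_q: "u \<in> deficient \<Longrightarrow> card (N u) \<le> q"
  using card_N[of u] by (simp add: deficient_def)

lemma card_loose_le: "u \<in> deficient \<Longrightarrow> card (loose u) \<le> q"
  using card_N_le_q[of u] card_mono[OF finN loose_sub(2), of u] by (force simp: deficient_def)

lemma sum_defect_deficient: "(\<Sum>u\<in>deficient. defect u) = total"
  unfolding total_def using finV defect_nonneg by (intro sum.mono_neutral_left) (force simp: deficient_def)+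

lemma card_deficient_le_total: "int (card deficient) \<le> total"
  using card_deficient_le[OF defect_nonneg, of V] by (simp add: total_def deficient_def Int_def)

text \<open>Markov's inequality for the excess \<open>ndefect t - defect r\<close>. It is
  nonnegative on \<open>N r\<close> because \<open>r\<close> itself is a neighbour of
  \<open>t\<close>.\<close>

lemma card_large_ndefect_nbrs:
  assumes r: "r \<in> V" and b: "real_of_int (defect r) + b \<le> a" and b0: "0 < b"
  shows "real (card {t \<in> N r. a \<le> real_of_int (ndefect t)}) * b \<le> real_of_int total"
proof -
  let ?A = "{t \<in> N r. a \<le> real_of_int (ndefect t)}"
  have f: "finite (N r)" using finN r .
  have ge: "defect r \<le> ndefect t" if "t \<in> N r" for t
  proof -
    have "r \<in> N t" "t \<in> V" using N_sym N_in_V r that by blast+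
    then show ?thesis unfolding ndefect_def
      using defect_nonneg N_in_V finN by (intro member_le_sum) auto
  qed
  have "real (card ?A) * b = (\<Sum>t\<in>?A. b)" by simp
  also have "\<dots> \<le> (\<Sum>t\<in>?A. real_of_int (ndefect t - defect r))"
    using b by (intro sum_mono) auto
  also have "\<dots> \<le> (\<Sum>t\<in>N r. real_of_int (ndefect t - defect r))"
    using f ge by (intro sum_mono2) (auto simp flip: of_int_diff)
  also have "\<dots> = real_of_int ((\<Sum>t\<in>N r. ndefect t) - int (card (N r)) * defect r)"
    by (simp add: sum_subtractf)
  also have "\<dots> \<le> real_of_int total"
  proof -
    have "0 \<le> (\<Sum>u\<in>unlinked r. defect u)" using defect_nonneg unlinked_sub by (intro sum_nonneg) blast
    then have "(\<Sum>t\<in>N r. ndefect t) - int (card (N r)) * defect r \<le> total"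
      using sum_ndefect_nbrs[OF r] defect_nonneg[OF r] by (simp add: card_N algebra_simps)
    then show ?thesis by (simp only: of_int_le_iff)
  qed
  finally show ?thesis .
qed

section \<open>Exceptional vertices and their number\<close>

context
  fixes e g h B :: real
  assumes e0: "0 < e" and tot: "real_of_int total \<le> (2 - e) * real q"
    and g0: "0 < g" and h0: "0 < h"
    and B: "B = real q ^ 2 - real q - 8 / e * (real q + 1)"
    and sqrt_small: "sqrt (2 * real q) \<le> e / 4 * real q"
    and light: "(2 - e) * real q - B / real q + 1 + e / 2 * real q \<le> real q - g - h * g"
    and apart: "(2 - e) * real q + h < 2 * (real q - g - h * g)"
    and hg: "h < real q - g"
    and count: "(1 - e / 2) * real q \<le> (B - e / 4 * real q ^ 2) / real q
       - (2 * real q * (1 + 24 / e) + (2 * real q + 2 * real q * sqrt (2 * real q))) / g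
       - 2 * real q / h - (2 * real q / h + 2 * real q / h * sqrt (2 * real q / h))
       - 2 * real q / h * (4 / e)"
begin

lemma q_pos: "0 < real q"
  using hg g0 h0 by linarith

lemma tot2: "real_of_int total \<le> 2 * real q"
proof -
  have "0 \<le> e * real q" using e0 by simp
  then show ?thesis using tot by (simp add: algebra_simps)
qed

lemma card_deficient_2q: "real (card deficient) \<le> 2 * real q"
  using card_deficient_le_total tot2 by linarith

text \<open>A far vertex has at least \<open>e / 2 * q\<close> deficient neighbours. At most half of
  this is absorbed by the square root term of \<open>edges_between_bound\<close>, which leaves
  \<open>2 * q\<close> divided by \<open>e / 4 * q\<close>.\<close>

lemma card_far: "real (card far) \<le> 8 / e"
proof -
  have farV: "far \<subseteq> V" "deficient \<subseteq> V" by (auto simp: far_def full_def deficient_def)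
  have "real (card far) * (e / 2 * real q) = (\<Sum>u\<in>far. e / 2 * real q)" by simp
  also have "\<dots> \<le> (\<Sum>u\<in>far. real (card (N u \<inter> deficient)))"
  proof (rule sum_mono)
    fix u assume "u \<in> far"
    then have "real_of_int (2 * (int q + 1)) \<le> real_of_int (total + 2 * int (card (N u \<inter> deficient)))"
      using far_deficient_nbrs by (simp only: of_int_le_iff)
    then show "e / 2 * real q \<le> real (card (N u \<inter> deficient))" using tot by (simp add: algebra_simps)
  qed
  also have "\<dots> \<le> real (card deficient) + real (card far) * sqrt (real (card deficient))"
    using edges_between_bound[OF farV] by simp
  also have "\<dots> \<le> 2 * real q + real (card far) * (e / 4 * real q)"
  proof (intro add_mono mult_left_mono)
    have "sqrt (real (card deficient)) \<le> sqrt (2 * real q)" using card_deficient_2q by simp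
    then show "sqrt (real (card deficient)) \<le> e / 4 * real q" using sqrt_small by linarith
  qed (use card_deficient_2q in auto)
  finally have "real (card far) * (e / 4 * real q) \<le> 2 * real q" by (simp add: algebra_simps)
  then have "real (card far) * e * real q \<le> 8 * real q" by (simp add: algebra_simps)
  then have "real (card far) * e \<le> 8" using q_pos by simp
  then show ?thesis using e0 by (simp add: field_simps)
qed

text \<open>\<open>B\<close> arises from \<open>card V\<close> by removing up to
  \<open>2 * q\<close> deficient vertices and the neighbourhoods of the far vertices.\<close>

lemma sum_loose_ge: "B \<le> (\<Sum>u\<in>deficient. real (card (loose u)))"
proof -
  have "card V = card full + card deficient"
    using V_split card_Un_disjoint fin_full fin_deficient by metis
  then have "real (card full) = real q ^ 2 + real q + 1 - real (card deficient)"
    unfolding cardV by (metis add_diff_cancel_right' of_nat_1 of_nat_add of_nat_power)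
  moreover define c where "c = 8 / e * (real q + 1)"
  have "real (card far) * (real q + 1) \<le> c"
    unfolding c_def using card_far by (intro mult_right_mono) auto
  then have "real (card full) \<le> (\<Sum>u\<in>deficient. real (card (loose u))) + c"
    using of_nat_mono[OF card_full_le_sum_loose, where ?'a = real] by (simp add: algebra_simps)
  moreover have "B = real q ^ 2 - real q - c" using B by (simp add: c_def)
  ultimately show ?thesis using card_deficient_2q by linarith
qed

lemma card_deficient_ge: "B / real q \<le> real (card deficient)"
proof -
  have "B \<le> (\<Sum>u\<in>deficient. real q)"
    using sum_loose_ge
  proof (rule order_trans)
    show "(\<Sum>u\<in>deficient. real (card (loose u))) \<le> (\<Sum>u\<in>deficient. real q)"
      using card_loose_le by (intro sum_mono) simp
  qed
  then show ?thesis using q_pos by (simp add: field_simps)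
qed

text \<open>Almost \<open>q\<close> deficient vertices use at least one unit of defect each, so a
  single vertex gets little more than \<open>(1 - e) * q\<close>.\<close>

lemma defect_le_light:
  assumes r: "r \<in> V"
  shows "real_of_int (defect r) \<le> (2 - e) * real q - B / real q + 1"
proof (cases "r \<in> deficient")
  case True
  have "int (card (deficient - {r})) \<le> (\<Sum>u\<in>deficient - {r}. defect u)"
    using sum_mono[of "deficient - {r}" "\<lambda>_. 1" defect] by (force simp: deficient_def)
  moreover have "total = defect r + (\<Sum>u\<in>deficient - {r}. defect u)"
    using sum.remove[OF fin_deficient True] sum_defect_deficient by metis
  moreover have "card (deficient - {r}) = card deficient - 1" "0 < card deficient"
    using True fin_deficient by (auto simp: card_gt_0_iff)
  ultimately have "defect r + int (card deficient) \<le> total + 1" by linarith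
  then have "real_of_int (defect r) + real (card deficient) \<le> real_of_int total + 1" by linarith
  then show ?thesis using card_deficient_ge tot by linarith
next
  case False
  then have "defect r = 0" using r V_split by (auto simp: full_def)
  moreover have "int (card deficient) \<le> total" by (rule card_deficient_le_total)
  then have "real (card deficient) \<le> real_of_int total" by linarith
  ultimately show ?thesis using card_deficient_ge tot by simp
qed

text \<open>A vertex is good if it is the end of nearly \<open>q\<close> triangle-free edges from full vertices, has small
  defect, and avoids the triangles with a vertex of defect more than \<open>h\<close>. The assumption \<open>count\<close> says
  that the exceptional vertices are few; it holds for large \<open>q\<close> with \<open>g = q powr 0.6\<close> and
  \<open>h = q powr 0.35\<close>.\<close>

definition strong :: "'a set" where
  "strong = {u \<in> deficient. e / 8 * real q \<le> real (card (loose u))}"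

definition gap :: "'a \<Rightarrow> real" where "gap u = real q - real (card (loose u))"

definition heavy :: "'a set" where "heavy = {u \<in> deficient. h < real_of_int (defect u)}"

definition bad1 :: "'a set" where "bad1 = {u \<in> strong. g < gap u}"

definition bad2 :: "'a set" where
  "bad2 = (\<Union>r\<in>heavy. \<Union>r'\<in>N r \<inter> heavy. N r \<inter> N r')"

text \<open>The threshold is the one that \<open>light_triangle_nbr\<close> establishes. So this set
  catches the triangles with one heavy and one light vertex besides \<open>u\<close>, and
  \<open>bad2\<close> those with two heavy ones.\<close>

definition bad3 :: "'a set" where
  "bad3 = (\<Union>r\<in>heavy. \<Union>r'\<in>{t \<in> N r. real q - g - h * g \<le> real_of_int (ndefect t)}. N r \<inter> N r')"

definition good :: "'a set" where
  "good = strong - bad1 - heavy - bad2 - bad3"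

lemma fin_strong: "finite strong" and fin_heavy: "finite heavy" and fin_bad1: "finite bad1"
  using fin_deficient by (auto simp: strong_def heavy_def bad1_def)

lemma heavy_V: "heavy \<subseteq> V"
  by (auto simp: heavy_def deficient_def)

lemma card_strong: "(B - e / 4 * real q ^ 2) / real q \<le> real (card strong)"
proof -
  have "B \<le> (\<Sum>u\<in>deficient. real (card (loose u)))" by (rule sum_loose_ge)
  also have "\<dots> \<le> (\<Sum>u\<in>deficient. (if u \<in> strong then real q else 0) + e / 8 * real q)"
  proof (rule sum_mono)
    fix u assume "u \<in> deficient"
    then show "real (card (loose u)) \<le> (if u \<in> strong then real q else 0) + e / 8 * real q"
      using card_loose_le[of u] e0 by (auto simp: strong_def add_increasing2)
  qed
  also have "\<dots> = real (card strong) * real q + real (card deficient) * (e / 8 * real q)"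
  proof -
    have "deficient \<inter> {u. u \<in> strong} = strong" by (auto simp: strong_def)
    then show ?thesis using fin_deficient by (simp add: sum.distrib sum.If_cases)
  qed
  also have "\<dots> \<le> real (card strong) * real q + (2 * real q) * (e / 8 * real q)"
    using card_deficient_2q e0 by (intro add_mono mult_right_mono) auto
  finally show ?thesis using q_pos by (simp add: field_simps power2_eq_square)
qed

text \<open>The gap consists of defect, triangle neighbours and deficient neighbours. As
  \<open>u\<close> has many loose edges, \<open>card_tight_bound\<close> makes the triangle
  neighbours few: 24 is 3 times the 8 in \<open>strong\<close>, where 3 bounds
  \<open>2 + defect u\<close> by a multiple of \<open>defect u\<close>.\<close>

lemma gap_bound:
  assumes u: "u \<in> strong"
  shows "gap u \<le> (1 + 24 / e) * real_of_int (defect u) + real (card (N u \<inter> deficient))"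
proof -
  have uS: "u \<in> deficient" "u \<in> V" "1 \<le> defect u" and lo: "e / 8 * real q \<le> real (card (loose u))"
    using u by (auto simp: strong_def deficient_def)
  have "real (card (tight u)) * (e / 8 * real q) \<le> real (card (tight u)) * real (card (loose u))"
    using lo by (intro mult_left_mono) auto
  also have "\<dots> \<le> real_of_int (total + int q * defect u)"
    using card_tight_bound[OF uS(2)] by (metis of_int_le_iff of_int_mult of_int_of_nat_eq)
  also have "\<dots> \<le> 2 * real q + real q * real_of_int (defect u)" using tot2 by simp
  also have "\<dots> \<le> real q * (3 * real_of_int (defect u))" using uS(3) q_pos by (simp add: algebra_simps)
  finally have "real q * (real (card (tight u)) * (e / 8)) \<le> real q * (3 * real_of_int (defect u))"
    by (simp add: algebra_simps)
  then have "real (card (tight u)) * (e / 8) \<le> 3 * real_of_int (defect u)" using q_pos by simp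
  then have "real (card (tight u)) \<le> 24 / e * real_of_int (defect u)" using e0 by (simp add: field_simps)
  moreover have "gap u = real_of_int (defect u) - 1 + real (card (tight u)) + real (card (N u \<inter> deficient))"
    using degree_split[OF uS(2)] unfolding gap_def by linarith
  ultimately show ?thesis by (simp add: algebra_simps)
qed

lemma card_bad1:
  "real (card bad1) \<le> (2 * real q * (1 + 24 / e) + (2 * real q + 2 * real q * sqrt (2 * real q))) / g"
proof -
  have SV: "deficient \<subseteq> V" by (auto simp: deficient_def)
  have e24: "0 \<le> 1 + 24 / e" using e0 by simp
  have "real (card bad1) * g = (\<Sum>u\<in>bad1. g)" by simp
  also have "\<dots> \<le> (\<Sum>u\<in>bad1. gap u)" by (intro sum_mono) (auto simp: bad1_def)
  also have "\<dots> \<le> (\<Sum>u\<in>bad1. (1 + 24 / e) * real_of_int (defect u) + real (card (N u \<inter> deficient)))"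
    by (intro sum_mono gap_bound) (auto simp: bad1_def)
  also have "\<dots> \<le> (\<Sum>u\<in>deficient. (1 + 24 / e) * real_of_int (defect u) + real (card (N u \<inter> deficient)))"
    using fin_deficient e0 by (intro sum_mono2) (auto simp: bad1_def strong_def deficient_def)
  also have "\<dots> = (1 + 24 / e) * real_of_int total + real (\<Sum>u\<in>deficient. card (N u \<inter> deficient))"
    by (simp add: sum.distrib sum_distrib_left[symmetric] sum_defect_deficient[symmetric])
  also have "\<dots> \<le> (1 + 24 / e) * (2 * real q) + (real (card deficient) + real (card deficient) * sqrt (real (card deficient)))"
    using tot2 e24 edges_between_bound[OF SV SV] by (intro add_mono mult_left_mono) auto
  also have "\<dots> \<le> (1 + 24 / e) * (2 * real q) + (2 * real q + 2 * real q * sqrt (2 * real q))"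
    using card_deficient_2q e24 by (intro add_mono mult_mono) auto
  finally show ?thesis using g0 by (simp add: pos_le_divide_eq mult.commute)
qed

lemma card_heavy: "real (card heavy) \<le> 2 * real q / h"
proof -
  have "real (card heavy) * h = (\<Sum>u\<in>heavy. h)" by simp
  also have "\<dots> \<le> (\<Sum>u\<in>heavy. real_of_int (defect u))" by (intro sum_mono) (auto simp: heavy_def)
  also have "\<dots> \<le> (\<Sum>u\<in>deficient. real_of_int (defect u))"
    using fin_deficient by (intro sum_mono2) (auto simp: heavy_def deficient_def)
  also have "\<dots> = real_of_int total" by (simp add: sum_defect_deficient[symmetric])
  finally show ?thesis using tot2 h0 by (simp add: pos_le_divide_eq)
qed

lemma card_bad2: "real (card bad2) \<le> 2 * real q / h + 2 * real q / h * sqrt (2 * real q / h)"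
proof -
  have "card bad2 \<le> (\<Sum>r\<in>heavy. card (\<Union>r'\<in>N r \<inter> heavy. N r \<inter> N r'))"
    unfolding bad2_def by (rule card_UN_le[OF fin_heavy])
  also have "\<dots> \<le> (\<Sum>r\<in>heavy. card (N r \<inter> heavy))"
  proof (rule sum_mono)
    fix r assume r: "r \<in> heavy"
    then have rV: "r \<in> V" using heavy_V by blast
    have "card (\<Union>r'\<in>N r \<inter> heavy. N r \<inter> N r') \<le> (\<Sum>r'\<in>N r \<inter> heavy. card (N r \<inter> N r'))"
      using fin_heavy by (intro card_UN_le) auto
    also have "\<dots> \<le> (\<Sum>r'\<in>N r \<inter> heavy. 1)"
      using rV heavy_V loopless by (intro sum_mono codeg_le) auto
    finally show "card (\<Union>r'\<in>N r \<inter> heavy. N r \<inter> N r') \<le> card (N r \<inter> heavy)" by simp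
  qed
  finally have "real (card bad2) \<le> real (\<Sum>r\<in>heavy. card (N r \<inter> heavy))" by (rule of_nat_mono)
  also have "\<dots> \<le> real (card heavy) + real (card heavy) * sqrt (real (card heavy))"
    by (rule edges_between_bound[OF heavy_V heavy_V])
  also have "\<dots> \<le> 2 * real q / h + 2 * real q / h * sqrt (2 * real q / h)"
    using card_heavy h0 by (intro add_mono mult_mono) auto
  finally show ?thesis .
qed

text \<open>By \<open>light\<close> the threshold exceeds every \<open>defect r\<close> by at least
  \<open>e / 2 * q\<close>, so only \<open>4 / e\<close> neighbours of a heavy vertex reach
  it.\<close>

lemma card_bad3: "real (card bad3) \<le> 2 * real q / h * (4 / e)"
proof -
  let ?A = "\<lambda>r. {t \<in> N r. real q - g - h * g \<le> real_of_int (ndefect t)}"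
  have "card bad3 \<le> (\<Sum>r\<in>heavy. card (\<Union>r'\<in>?A r. N r \<inter> N r'))"
    unfolding bad3_def by (rule card_UN_le[OF fin_heavy])
  also have "\<dots> \<le> (\<Sum>r\<in>heavy. card (?A r))"
  proof (rule sum_mono)
    fix r assume r: "r \<in> heavy"
    then have rV: "r \<in> V" using heavy_V by blast
    have "card (\<Union>r'\<in>?A r. N r \<inter> N r') \<le> (\<Sum>r'\<in>?A r. card (N r \<inter> N r'))"
      using finN[OF rV] by (intro card_UN_le) auto
    also have "\<dots> \<le> (\<Sum>r'\<in>?A r. 1)"
      using rV N_in_V loopless by (intro sum_mono codeg_le) auto
    finally show "card (\<Union>r'\<in>?A r. N r \<inter> N r') \<le> card (?A r)" by simp
  qed
  finally have "real (card bad3) \<le> (\<Sum>r\<in>heavy. real (card (?A r)))"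
    using of_nat_mono[where ?'a = real] by fastforce
  also have "\<dots> \<le> (\<Sum>r\<in>heavy. 4 / e)"
  proof (rule sum_mono)
    fix r assume "r \<in> heavy"
    then have rV: "r \<in> V" using heavy_V by blast
    have "real (card (?A r)) * (e / 2 * real q) \<le> real_of_int total"
      using light defect_le_light[OF rV] e0 q_pos by (intro card_large_ndefect_nbrs[OF rV]) auto
    then have "real q * (real (card (?A r)) * e) \<le> real q * 4" using tot2 by (simp add: algebra_simps)
    then have "real (card (?A r)) * e \<le> 4" using q_pos by simp
    then show "real (card (?A r)) \<le> 4 / e" using e0 by (simp add: field_simps)
  qed
  also have "\<dots> = real (card heavy) * (4 / e)" by simp
  also have "\<dots> \<le> 2 * real q / h * (4 / e)" using card_heavy e0 by (intro mult_right_mono) auto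
  finally show ?thesis .
qed

lemma card_good: "(1 - e / 2) * real q \<le> real (card good)"
proof -
  have "real (card strong) - real (card bad1) - real (card heavy) - real (card bad2) - real (card bad3) \<le> real (card good)"
  proof -
    have f: "finite bad2" "finite bad3"
      unfolding bad2_def bad3_def using fin_heavy finN heavy_V by (auto intro!: finite_UN_I)
    have "card strong \<le> card (good \<union> (bad1 \<union> (heavy \<union> (bad2 \<union> bad3))))"
      using f fin_strong fin_bad1 fin_heavy by (intro card_mono) (auto simp: good_def)
    also have "\<dots> \<le> card good + (card bad1 + (card heavy + (card bad2 + card bad3)))"
      by (meson add_left_mono card_Un_le order_trans)
    finally show ?thesis by linarith
  qed
  then show ?thesis using count card_strong card_bad1 card_heavy card_bad2 card_bad3 by linarith
qed

section \<open>Good vertices lie in no triangle and are pairwise nonadjacent\<close>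

lemma goodD:
  assumes "u \<in> good"
  shows "u \<in> deficient" "u \<in> V" "1 \<le> defect u" "gap u \<le> g" "real_of_int (defect u) \<le> h"
  using assms by (auto simp: good_def strong_def bad1_def heavy_def deficient_def)

lemma good_defect_less_loose:
  assumes "u \<in> good"
  shows "real_of_int (defect u) < real (card (loose u))"
  using goodD[OF assms] hg by (simp add: gap_def)

lemma apart_contra:
  assumes a: "real q - g - h * g \<le> a" and b: "real q - g - h * g \<le> b"
    and ab: "a + b \<le> real_of_int total + h"
  shows False
proof -
  have "2 * (real q - g - h * g) \<le> a + b" using add_mono[OF a b] by (simp only: mult_2)
  also note ab
  also have "real_of_int total + h \<le> (2 - e) * real q + h" using tot by simp
  finally show False using apart by simp
qed

lemma light_triangle_nbr:
  assumes u: "u \<in> good" and r: "r \<in> N u" "r \<notin> unlinked u" "real_of_int (defect r) \<le> h"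
  shows "real q - g - h * g \<le> real_of_int (ndefect r)"
proof -
  have rV: "r \<in> V" "u \<in> V" using N_in_V r goodD[OF u] by blast+
  have gap0: "0 \<le> gap u" using card_loose_le[OF goodD(1)[OF u]] by (simp add: gap_def)
  have "(1 + real_of_int (defect r)) * real (card (loose u)) \<le> real q * real_of_int (defect r) + real_of_int (ndefect r)"
    using triangle_nbr_ndefect[OF rV(2) r(1,2)]
    by (metis (mono_tags, lifting) of_int_1 of_int_add of_int_le_iff of_int_mult of_int_of_nat_eq)
  then have "real q - gap u - real_of_int (defect r) * gap u \<le> real_of_int (ndefect r)"
    by (simp add: gap_def algebra_simps)
  moreover have "real_of_int (defect r) * gap u \<le> h * g"
    using r(3) goodD(4)[OF u] gap0 defect_nonneg[OF rV(1)] h0 by (intro mult_mono) auto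
  ultimately show ?thesis using goodD(4)[OF u] by linarith
qed

text \<open>Two light vertices \<open>r\<close> and \<open>r'\<close> in a triangle with
  \<open>u\<close> would each see almost \<open>q\<close> units of defect in their neighbourhoods,
  which share only \<open>u\<close>; that exceeds the total. Triangles with a heavy vertex were
  excluded by \<open>bad2\<close> and \<open>bad3\<close>.\<close>

lemma good_triangle_free:
  assumes u: "u \<in> good"
  shows "N u \<subseteq> unlinked u"
proof (rule ccontr)
  assume "\<not> ?thesis"
  then obtain r where r: "r \<in> N u" "r \<notin> unlinked u" by blast
  have uV: "u \<in> V" using goodD[OF u] by blast
  have rV: "r \<in> V" "r \<noteq> u" using N_in_V uV r loopless by blast+
  then obtain r' where r': "r' \<in> N u" "r' \<in> N r" using r by (auto simp: unlinked_def)
  have r'V: "r' \<in> V" "r' \<noteq> r" using N_in_V uV r' loopless rV by blast+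
  have rr': "r \<in> N r'" using N_sym rV r' by blast
  have nr': "r' \<notin> unlinked u" using r(1) rr' by (auto simp: unlinked_def)
  have ur: "u \<in> N r" "u \<in> N r'" using N_sym uV r r' by blast+
  have heavy: "x \<in> heavy" if "x \<in> V" "\<not> real_of_int (defect x) \<le> h" for x
    using that h0 by (auto simp: heavy_def deficient_def)
  have b: "u \<notin> bad2" "u \<notin> bad3" using u by (auto simp: good_def)
  consider "real_of_int (defect r) \<le> h" "real_of_int (defect r') \<le> h"
    | "r \<in> heavy" "r' \<in> heavy"
    | "r \<in> heavy" "real_of_int (defect r') \<le> h"
    | "r' \<in> heavy" "real_of_int (defect r) \<le> h"
    using heavy rV r'V by blast
  then show False
  proof cases
    case 1
    have "N r \<inter> N r' = {u}" using codeg[OF rV(1) r'V(1)] r'V(2) ur by blast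
    then have "ndefect r + ndefect r' \<le> total + defect u"
      using ndefect_add_le[OF rV(1) r'V(1)] by simp
    then have "real_of_int (ndefect r) + real_of_int (ndefect r') \<le> real_of_int total + real_of_int (defect u)"
      by linarith
    then have "real_of_int (ndefect r) + real_of_int (ndefect r') \<le> real_of_int total + h"
      using goodD(5)[OF u] by linarith
    then show False
      using apart_contra[OF light_triangle_nbr[OF u r 1(1)] light_triangle_nbr[OF u r'(1) nr' 1(2)]] by blast
  next
    case 2
    then show False using b(1) ur r' unfolding bad2_def by blast
  next
    case 3
    then show False using b(2) ur r' light_triangle_nbr[OF u r'(1) nr' 3(2)] unfolding bad3_def by blast
  next
    case 4
    then show False using b(2) ur rr' light_triangle_nbr[OF u r 4(2)] unfolding bad3_def by blast
  qed
qed

text \<open>For each \<open>t\<close> in \<open>loose v\<close> the walk identity gives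
  \<open>defect u\<close> vertices of \<open>N t\<close> unlinked to \<open>u\<close>, not counting
  \<open>v\<close>. They are disjoint for different \<open>t\<close> and disjoint from
  \<open>N u\<close>, which also lies in \<open>unlinked u\<close> because \<open>u\<close> is in no
  triangle. The contribution of \<open>N u\<close> is the main term of the bound.\<close>

lemma adjacent_good_ndefect:
  assumes u: "u \<in> good" and v: "v \<in> good" and uv: "v \<in> N u"
  shows "real q - g - h * g \<le> real_of_int (ndefect u)"
proof -
  have V: "u \<in> V" "v \<in> V" "u \<in> N v" "u \<noteq> v" using goodD u v N_sym uv loopless by blast+
  have Uu: "N u \<subseteq> unlinked u" and Uv: "N v \<subseteq> unlinked v" using good_triangle_free u v by blast+
  have tprop: "t \<in> V" "t \<in> full" "t \<noteq> u" "v \<in> N t" "t \<notin> N u" if t: "t \<in> loose v" for t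
  proof -
    show "t \<in> V" "t \<in> full" using t loose_sub fullD by blast+
    show "t \<noteq> u" using t goodD(3)[OF u] loose_sub fullD(2) by force
    show "v \<in> N t" using t loose_sub N_sym V by blast
    show "t \<notin> N u" using Uu uv t loose_sub unlinked_no_common[of v u t] by blast
  qed
  have big: "defect u \<le> int (card (N t \<inter> unlinked u - {v}))" if t: "t \<in> loose v" for t
  proof -
    note tp = tprop[OF t]
    have "u \<notin> N t" using tp N_sym by blast
    then have "int (card (N t \<inter> unlinked u)) = defect u + int (card (N u \<inter> unlinked t))"
      using walk3_identity[OF tp(1) V(1) tp(3)] tp(2) by (simp add: full_def)
    moreover have "v \<in> N u \<inter> unlinked t"
      using uv t loose_sub(3) unlinked_sym[OF V(2)] by blast
    then have "0 < card (N u \<inter> unlinked t)" using finN V by (auto simp: card_gt_0_iff)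
    moreover have "v \<in> N t \<inter> unlinked u" using tp uv Uu by blast
    then have "card (N t \<inter> unlinked u - {v}) = card (N t \<inter> unlinked u) - 1" by simp
    ultimately show ?thesis by linarith
  qed
  define A where "A = (\<Union>t\<in>loose v. N t \<inter> unlinked u - {v})"
  have "int (card (loose v)) * defect u = (\<Sum>t\<in>loose v. defect u)" by simp
  also have "\<dots> \<le> (\<Sum>t\<in>loose v. int (card (N t \<inter> unlinked u - {v})))" using big by (rule sum_mono)
  also have "\<dots> = int (card A)"
  proof -
    have "(N t \<inter> unlinked u - {v}) \<inter> (N t' \<inter> unlinked u - {v}) = {}"
      if "t \<in> loose v" "t' \<in> loose v" "t \<noteq> t'" for t t'
      using codeg[OF tprop(1)[OF that(1)] tprop(1)[OF that(2)] that(3)] tprop(4)[OF that(1)] tprop(4)[OF that(2)] by blast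
    then show ?thesis unfolding A_def using fin_loose fin_unlinked by (subst card_UN_disjoint) auto
  qed
  finally have 1: "int (card (loose v)) * defect u \<le> int (card A)" .
  have "A \<inter> N u = {}"
  proof -
    have "x = v" if "t \<in> loose v" "x \<in> N t" "x \<in> N u" for t x
      using codeg[OF tprop(1)[OF that(1)] V(1) tprop(3)[OF that(1)] that(2,3) tprop(4)[OF that(1)] uv] .
    then show ?thesis unfolding A_def by blast
  qed
  moreover have "A \<subseteq> unlinked u" by (auto simp: A_def)
  ultimately have "card A + card (N u) \<le> card (unlinked u)"
    using Uu fin_unlinked card_Un_disjoint[of A "N u"] finN[OF V(1)] card_mono[of "unlinked u" "A \<union> N u"]
    by (metis Un_least finite_subset)
  then have "int (card (loose v)) * defect u + int (card (N u)) \<le> int q * defect u + ndefect u"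
    using 1 card_unlinked[OF V(1)] by linarith
  then have "real (card (loose v)) * real_of_int (defect u) + real (card (N u)) \<le> real q * real_of_int (defect u) + real_of_int (ndefect u)"
    by (metis (mono_tags, lifting) of_int_add of_int_le_iff of_int_mult of_int_of_nat_eq)
  then have "real (card (N u)) - real_of_int (defect u) * gap v \<le> real_of_int (ndefect u)"
    by (simp add: gap_def algebra_simps)
  moreover have "real_of_int (defect u) * gap v \<le> h * g"
    using goodD[OF u] goodD[OF v] card_loose_le[OF goodD(1)[OF v]] h0
    by (intro mult_mono) (auto simp: gap_def)
  moreover have "real q - g \<le> real (card (N u))"
    using goodD(4)[OF u] card_mono[OF finN[OF V(1)] loose_sub(2)] by (simp add: gap_def)
  ultimately show ?thesis by linarith
qed

lemma good_independent:
  assumes u: "u \<in> good" and v: "v \<in> good"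
  shows "v \<notin> N u"
proof
  assume uv: "v \<in> N u"
  have V: "u \<in> V" "v \<in> V" "u \<in> N v" using goodD u v N_sym uv by blast+
  have "N u \<inter> N v = {}" using good_triangle_free[OF u] uv by (auto simp: unlinked_def)
  then have "ndefect u + ndefect v \<le> total" using ndefect_add_le[OF V(1,2)] by simp
  then have "real_of_int (ndefect u) + real_of_int (ndefect v) \<le> real_of_int total + h" using h0 by linarith
  then show False
    using apart_contra[OF adjacent_good_ndefect[OF u v uv] adjacent_good_ndefect[OF v u V(3)]] by blast
qed

lemma exists_many_absolute_points:
  "\<exists>W\<subseteq>V. (1 - e / 2) * real q \<le> real (card W) \<and>
     (\<forall>u\<in>W. 1 \<le> defect u \<and> N u \<subseteq> unlinked u \<and> defect u < int (card (loose u)) \<and> (\<forall>v\<in>W. v \<notin> N u))"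
proof (intro exI[of _ good] conjI ballI)
  show "good \<subseteq> V" using goodD by blast
  show "(1 - e / 2) * real q \<le> real (card good)" by (rule card_good)
next
  fix u assume u: "u \<in> good"
  show "1 \<le> defect u" "N u \<subseteq> unlinked u" using goodD good_triangle_free u by blast+
  show "defect u < int (card (loose u))" using good_defect_less_loose[OF u] by linarith
  show "v \<notin> N u" if "v \<in> good" for v using good_independent[OF u that] .
qed

end

end

section \<open>Graphs of maximum degree at most \<open>q + 1\<close>\<close>

lemma (in c4free_graph) full_row:
  assumes R: "partial_polarity q V V R" and x: "x \<in> full" "N x \<subseteq> R x"
  shows "R x = N x"
proof -
  have "x \<in> V" "int (card (N x)) = int q + 1" using x fullD card_N[of x] by auto
  then show ?thesis using card_subset_eq[of "R x" "N x"] partial_polarityD(3,4)[OF R] x(2) by simp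
qed

text \<open>If \<open>u\<close> is not absolute, the line of each \<open>t\<close> in
  \<open>loose u\<close> meets \<open>R u\<close> outside \<open>N u\<close>, at different points
  for different \<open>t\<close> since two such \<open>t\<close> share only \<open>u\<close>. But
  only \<open>defect u\<close> points of \<open>R u\<close> lie outside \<open>N u\<close>.\<close>

lemma (in c4free_graph) absolute_point_forced:
  assumes R: "partial_polarity q V V R" and NR: "\<And>x. x \<in> V \<Longrightarrow> N x \<subseteq> R x"
    and u: "u \<in> V" "1 \<le> defect u" "defect u < int (card (loose u))"
  shows "u \<in> R u"
proof (rule ccontr)
  assume nu: "u \<notin> R u"
  note D = partial_polarityD[OF R]
  have t: "t \<in> V" "t \<in> full" "t \<noteq> u" "u \<in> N t" "t \<in> unlinked u" "R t = N t" if "t \<in> loose u" for t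
  proof -
    show F: "t \<in> full" and tV: "t \<in> V" and "t \<in> unlinked u" using that loose_sub fullD by blast+
    show "t \<noteq> u" using F u(2) by (auto simp: full_def)
    show "u \<in> N t" using that loose_sub N_sym u(1) by blast
    show "R t = N t" using full_row[OF R F] NR tV by blast
  qed
  have ex: "\<exists>r. r \<in> N t \<and> r \<in> R u - N u" if "t \<in> loose u" for t
  proof -
    note tt = t[OF that]
    obtain r where "R u \<inter> R t = {r}" using D(6)[OF u(1) tt(1)] tt(3) by blast
    then have "r \<in> R u" "r \<in> N t" using tt(6) by auto
    moreover have "r \<notin> N u" using unlinked_no_common[OF tt(5), of r] \<open>r \<in> N t\<close> by blast
    ultimately show ?thesis by blast
  qed
  define f where "f t = (SOME r. r \<in> N t \<and> r \<in> R u - N u)" for t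
  have f: "f t \<in> N t" "f t \<in> R u - N u" if "t \<in> loose u" for t
    using someI_ex[OF ex[OF that]] by (auto simp: f_def)
  have "inj_on f (loose u)"
  proof (rule inj_onI, rule ccontr)
    fix t t' assume a: "t \<in> loose u" "t' \<in> loose u" "f t = f t'" "t \<noteq> t'"
    then have "f t \<in> N t'" using f(1)[OF a(2)] by simp
    then have "f t = u"
      using codeg[OF t(1)[OF a(1)] t(1)[OF a(2)] a(4) f(1)[OF a(1)] _ t(4)[OF a(1)] t(4)[OF a(2)]] by blast
    then show False using f(2)[OF a(1)] nu by simp
  qed
  then have "card (loose u) \<le> card (R u - N u)"
    using f D(4)[OF u(1)] by (intro card_inj_on_le[of f]) auto
  also have "\<dots> = card (R u) - card (N u)"
    using NR[OF u(1)] finN[OF u(1)] by (rule card_Diff_subset[rotated])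
  finally show False
    using u(3) D(3)[OF u(1)] card_N[of u] card_mono[OF D(4) NR, OF u(1) u(1)] by linarith
qed

text \<open>The vertices in \<open>W\<close> become absolute points: adding loops there lowers the total defect below
  \<open>q\<close>, and every polarity graph above the given graph has these loops.\<close>

lemma (in c4free_graph) polarity_from_absolute_points:
  fixes e :: real
  assumes WV: "W \<subseteq> V" and cW: "(1 - e) * real q \<le> real (card W)"
    and W: "\<And>u. u \<in> W \<Longrightarrow> 1 \<le> defect u" "\<And>u. u \<in> W \<Longrightarrow> N u \<subseteq> unlinked u"
      "\<And>u. u \<in> W \<Longrightarrow> defect u < int (card (loose u))" "\<And>u v. u \<in> W \<Longrightarrow> v \<in> W \<Longrightarrow> v \<notin> N u"
    and e0: "0 < e" and tot: "real_of_int total \<le> (2 - 2 * e) * real q"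
    and big: "real q < e * real q * (e * real q - sqrt (real q))" and big3: "3 \<le> e * real q"
  shows "\<exists>R. partial_polarity q V V R \<and> (\<forall>x\<in>V. N x \<subseteq> R x) \<and>
    (\<forall>R'. partial_polarity q V V R' \<longrightarrow> (\<forall>x\<in>V. N x \<subseteq> R' x) \<longrightarrow> (\<forall>x\<in>V. R' x = R x))"
proof -
  define N' where "N' x = (if x \<in> W then insert x (N x) else N x)" for x
  have disj: "N x \<inter> N y = {}" if "x \<in> W \<or> y \<in> W" "y \<in> N x" "x \<in> V" for x y
    using that W(2)[of x] W(2)[of y] N_sym[of x y] by (auto simp: unlinked_def)
  \<comment> \<open>A loop at \<open>u\<close> creates the common neighbour \<open>u\<close> of
    \<open>u\<close> and each of its neighbours. By \<open>W(2)\<close> they had none before, and by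
    \<open>W(4)\<close> no edge receives loops at both ends.\<close>
  interpret L: c4free_rel V N' q
  proof
    show "x \<in> V \<Longrightarrow> N' x \<subseteq> V" for x using N_sub by (auto simp: N'_def)
    show "x \<in> V \<Longrightarrow> y \<in> N' x \<Longrightarrow> x \<in> N' y" for x y using N_sym by (auto simp: N'_def split: if_splits)
    have aux: "a = b"
      if V: "x \<in> V" "y \<in> V" "x \<noteq> y" and a: "a \<in> N x" "a \<in> N y" and b: "b \<in> N' x" "b \<in> N' y" for x y a b
    proof -
      have no: "\<not> (y \<in> N x \<and> (x \<in> W \<or> y \<in> W))" using disj[of x y] V a by blast
      have "b \<in> N x" using b no V N_sym[of x y] N_sym[of y x] by (cases "b = x") (auto simp: N'_def split: if_splits)
      moreover have "b \<in> N y" using b no V N_sym[of x y] N_sym[of y x] by (cases "b = y") (auto simp: N'_def split: if_splits)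
      ultimately show ?thesis using codeg[OF V a] by blast
    qed
    show "a = b" if V: "x \<in> V" "y \<in> V" "x \<noteq> y" and a: "a \<in> N' x" "a \<in> N' y" and b: "b \<in> N' x" "b \<in> N' y" for x y a b
    proof (cases "(a \<in> N x \<and> a \<in> N y) \<or> (b \<in> N x \<and> b \<in> N y)")
      case True
      then show ?thesis using aux[OF V] a b by metis
    next
      case False
      then have "(a = x \<and> x \<in> W \<and> x \<in> N y) \<or> (a = y \<and> y \<in> W \<and> y \<in> N x)"
        "(b = x \<and> x \<in> W \<and> x \<in> N y) \<or> (b = y \<and> y \<in> W \<and> y \<in> N x)"
        using a b V by (auto simp: N'_def split: if_splits)
      then show ?thesis using W(4) by blast
    qed
  qed (fact finV cardV)+
  have dL: "L.defect x = defect x - (if x \<in> W then 1 else 0)" if "x \<in> V" for x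
    using that finN loopless by (simp add: L.defect_def defect_def N'_def)
  have L_nonneg: "0 \<le> L.defect x" if "x \<in> V" for x
    using dL[OF that] W(1)[of x] defect_nonneg[OF that] by auto
  have "L.total = total - int (card W)"
  proof -
    have "L.total = (\<Sum>x\<in>V. defect x - (if x \<in> W then 1 else 0))"
      unfolding L.total_def using dL by (rule sum.cong[OF refl])
    also have "\<dots> = total - (\<Sum>x\<in>V. if x \<in> W then 1 else 0)" by (simp add: sum_subtractf total_def)
    also have "(\<Sum>x\<in>V. if x \<in> W then 1 else 0) = int (card W)"
      using WV finV by (simp add: sum.If_cases Int_absorb1)
    finally show ?thesis .
  qed
  then have L_tot: "real_of_int L.total \<le> (1 - e) * real q" using tot cW by (simp add: algebra_simps)
  obtain R where R: "partial_polarity q V V R" and NR: "\<And>x y. x \<in> V \<Longrightarrow> y \<in> N' x \<Longrightarrow> y \<noteq> x \<Longrightarrow> y \<in> R x"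
    using L.exists_polarity_above[OF L_nonneg e0 L_tot big big3] by blast
  have NR': "N x \<subseteq> R x" if "x \<in> V" for x
  proof
    fix y assume "y \<in> N x"
    then have "y \<in> N' x" "y \<noteq> x" using loopless[OF that] by (auto simp: N'_def)
    then show "y \<in> R x" using NR[OF that] by blast
  qed
  have rows: "P x = N' x"
    if P: "partial_polarity q V V P" and NP: "\<And>x. x \<in> V \<Longrightarrow> N x \<subseteq> P x" and x: "x \<in> V" "L.defect x = 0" for P x
  proof -
    have "N' x \<subseteq> P x"
      using NP[OF x(1)] absolute_point_forced[OF P NP x(1) W(1) W(3)] by (auto simp: N'_def)
    moreover have "card (N' x) = q + 1" using L.card_N[of x] x(2) by simp
    ultimately show ?thesis
      using card_subset_eq[of "P x" "N' x"] partial_polarityD(3,4)[OF P x(1)] by simp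
  qed
  have "P x = R x"
    if P: "partial_polarity q V V P" and NP: "\<And>x. x \<in> V \<Longrightarrow> N x \<subseteq> P x" and x: "x \<in> V" for P x
  proof (rule partial_polarity_unique[OF P R finV cardV _ L.card_V_minus_full[OF L_nonneg e0 L_tot big big3] _ x])
    fix y assume "y \<in> {x \<in> V. L.defect x = 0}"
    then show "P y = R y" using rows[OF P NP] rows[OF R NR'] by simp
  qed auto
  then show ?thesis using R NR' by blast
qed

text \<open>The exponents must satisfy three demands: \<open>g\<close> outgrows
  \<open>q powr (1/2)\<close> for \<open>bad1\<close>, of order \<open>q * sqrt q / g\<close>;
  \<open>h\<close> outgrows \<open>q powr (1/3)\<close> for \<open>bad2\<close>, of order
  \<open>(q / h) powr (3/2)\<close>; and \<open>h * g\<close> is of smaller order than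
  \<open>q\<close>.\<close>

lemma eventually_parameters:
  fixes e :: real
  assumes e0: "0 < e"
  defines "g \<equiv> \<lambda>q::nat. real q powr 0.6" and "h \<equiv> \<lambda>q::nat. real q powr 0.35"
    and "B \<equiv> \<lambda>q::nat. real q ^ 2 - real q - 8 / e * (real q + 1)"
  shows "eventually (\<lambda>q. 0 < g q \<and> 0 < h q) at_top"
    "eventually (\<lambda>q::nat. sqrt (2 * real q) \<le> e / 4 * real q) at_top"
    "eventually (\<lambda>q. (2 - e) * real q - B q / real q + 1 + e / 2 * real q \<le> real q - g q - h q * g q) at_top"
    "eventually (\<lambda>q. (2 - e) * real q + h q < 2 * (real q - g q - h q * g q)) at_top"
    "eventually (\<lambda>q. h q < real q - g q) at_top"
    "eventually (\<lambda>q. (1 - e / 2) * real q \<le> (B q - e / 4 * real q ^ 2) / real q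
       - (2 * real q * (1 + 24 / e) + (2 * real q + 2 * real q * sqrt (2 * real q))) / g q
       - 2 * real q / h q - (2 * real q / h q + 2 * real q / h q * sqrt (2 * real q / h q))
       - 2 * real q / h q * (4 / e)) at_top"
    "eventually (\<lambda>q::nat. real q < e / 2 * real q * (e / 2 * real q - sqrt (real q))) at_top"
    "eventually (\<lambda>q::nat. 3 \<le> e / 2 * real q) at_top"
proof -
  show "eventually (\<lambda>q. 0 < g q \<and> 0 < h q) at_top"
    unfolding g_def h_def using eventually_gt_at_top[of 0] by eventually_elim auto
  show "eventually (\<lambda>q::nat. sqrt (2 * real q) \<le> e / 4 * real q) at_top"
    using e0 by real_asymp
  show "eventually (\<lambda>q. (2 - e) * real q - B q / real q + 1 + e / 2 * real q \<le> real q - g q - h q * g q) at_top"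
    unfolding g_def h_def B_def using e0 by real_asymp
  show "eventually (\<lambda>q. (2 - e) * real q + h q < 2 * (real q - g q - h q * g q)) at_top"
    unfolding g_def h_def B_def using e0 by real_asymp
  show "eventually (\<lambda>q. h q < real q - g q) at_top"
    unfolding g_def h_def B_def by real_asymp
  show "eventually (\<lambda>q. (1 - e / 2) * real q \<le> (B q - e / 4 * real q ^ 2) / real q
       - (2 * real q * (1 + 24 / e) + (2 * real q + 2 * real q * sqrt (2 * real q))) / g q
       - 2 * real q / h q - (2 * real q / h q + 2 * real q / h q * sqrt (2 * real q / h q))
       - 2 * real q / h q * (4 / e)) at_top"
    unfolding g_def h_def B_def using e0 by real_asymp
  show "eventually (\<lambda>q::nat. real q < e / 2 * real q * (e / 2 * real q - sqrt (real q))) at_top"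
    using e0 by real_asymp
  show "eventually (\<lambda>q::nat. 3 \<le> e / 2 * real q) at_top"
    using e0 by real_asymp
qed

theorem eventually_unique_polarity:
  fixes e :: real
  assumes e0: "0 < e"
  shows "eventually (\<lambda>q. even q \<longrightarrow> (\<forall>(V::'a set) N. c4free_rel V N q \<longrightarrow> (\<forall>x\<in>V. x \<notin> N x) \<longrightarrow>
     (\<forall>x\<in>V. 0 \<le> c4free_rel.defect N q x) \<longrightarrow> real_of_int (c4free_rel.total V N q) \<le> (2 - e) * real q \<longrightarrow>
     (\<exists>R. partial_polarity q V V R \<and> (\<forall>x\<in>V. N x \<subseteq> R x) \<and>
       (\<forall>R'. partial_polarity q V V R' \<longrightarrow> (\<forall>x\<in>V. N x \<subseteq> R' x) \<longrightarrow> (\<forall>x\<in>V. R' x = R x))))) at_top"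
  using eventually_parameters[OF assms]
proof eventually_elim
  case (elim q)
  show ?case
  proof (intro impI allI)
    fix V :: "'a set" and N
    assume ev: "even q" and rel: "c4free_rel V N q" and ll: "\<forall>x\<in>V. x \<notin> N x"
      and nn: "\<forall>x\<in>V. 0 \<le> c4free_rel.defect N q x" and tot: "real_of_int (c4free_rel.total V N q) \<le> (2 - e) * real q"
    have "real_of_int (c4free_rel.total V N q + 2) \<le> real_of_int (2 * int q)"
      using tot elim(8) by (simp add: algebra_simps)
    then have "c4free_rel.total V N q + 2 \<le> 2 * int q" by (simp only: of_int_le_iff)
    then interpret c4free_graph V N q
      using rel ll nn ev by (intro c4free_graph.intro c4free_graph_axioms.intro) auto
    obtain W where W: "W \<subseteq> V" "(1 - e / 2) * real q \<le> real (card W)"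
      "\<And>u. u \<in> W \<Longrightarrow> 1 \<le> defect u" "\<And>u. u \<in> W \<Longrightarrow> N u \<subseteq> unlinked u"
      "\<And>u. u \<in> W \<Longrightarrow> defect u < int (card (loose u))" "\<And>u v. u \<in> W \<Longrightarrow> v \<in> W \<Longrightarrow> v \<notin> N u"
      using exists_many_absolute_points[OF e0 tot _ _ refl elim(2-6)] elim(1) by blast
    have "real_of_int total \<le> (2 - 2 * (e / 2)) * real q" using tot by simp
    then show "\<exists>R. partial_polarity q V V R \<and> (\<forall>x\<in>V. N x \<subseteq> R x) \<and>
       (\<forall>R'. partial_polarity q V V R' \<longrightarrow> (\<forall>x\<in>V. N x \<subseteq> R' x) \<longrightarrow> (\<forall>x\<in>V. R' x = R x))"
      using polarity_from_absolute_points[OF W _ _ elim(7,8)] e0 by simp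
  qed
qed

section \<open>Vertices of degree greater than \<open>q + 1\<close>\<close>

context c4free_rel
begin

text \<open>Counting the pairs outside the neighbourhood of a vertex of degree at least \<open>q + 3\<close>: every
  other vertex loses at most one neighbour, and \<open>x (x - 1)\<close> is bounded below by its secant
  through \<open>q - 1\<close> and \<open>q\<close>.\<close>

lemma defect_ge_minus_1:
  assumes loopless: "\<And>x. x \<in> V \<Longrightarrow> x \<notin> N x" and tot: "total + 2 \<le> 2 * int q" and q2: "2 \<le> q"
    and v: "v \<in> V"
  shows "-1 \<le> defect v"
proof (rule ccontr)
  assume a: "\<not> ?thesis"
  define k where "k = - defect v"
  have k2: "2 \<le> k" using a by (simp add: k_def)
  define X where "X = V - N v"
  have XV: "X \<subseteq> V" and fX: "finite X" using finV by (auto simp: X_def)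
  define n where "n = int q * int q + int q + 1"
  have n: "int (card V) = n" by (simp add: cardV n_def power2_eq_square)
  have cNv: "int (card (N v)) = int q + 1 + k" using card_N[of v] by (simp add: k_def)
  have "int (card X) = int (card V) - int (card (N v))"
    unfolding X_def using N_sub[OF v] finV by (simp add: card_Diff_subset finN[OF v] card_mono of_nat_diff)
  then have cX: "int (card X) = int q * int q - k" using n cNv by (simp add: n_def)
  have "card (N v) < card V"
    using N_sub[OF v] loopless[OF v] finV v by (intro psubset_card_mono) auto
  then have "int (card (N v)) \<le> int (card V) - 1" by linarith
  then have kq: "k \<le> int q * int q - 1" using cNv n by (simp add: n_def)
  define x where "x u = int (card (N u \<inter> X))" for u
  have "(\<Sum>u\<in>V. (x u - 1) * x u) = (\<Sum>t\<in>X. \<Sum>u\<in>N t \<inter> V. x u - 1)"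
    using sum_over_nbrs[OF XV subset_refl, of "\<lambda>u. x u - 1"] by (simp add: x_def)
  also have "\<dots> \<le> (\<Sum>t\<in>X. int (card X) - 1)"
  proof (rule sum_mono)
    fix t assume t: "t \<in> X"
    then have tV: "t \<in> V" using XV by blast
    have "(\<Sum>u\<in>N t. card (N u \<inter> X)) = (\<Sum>u\<in>X. card (N u \<inter> N t))"
      using N_sub[OF tV] XV by (rule edges_between_commute)
    also have "\<dots> = card (N t) + (\<Sum>u\<in>X - {t}. card (N u \<inter> N t))"
      using sum.remove[OF fX t, of "\<lambda>u. card (N u \<inter> N t)"] by simp
    also have "\<dots> \<le> card (N t) + (\<Sum>u\<in>X - {t}. 1)"
      using XV tV by (intro add_left_mono sum_mono codeg_le) auto
    finally have "(\<Sum>u\<in>N t. card (N u \<inter> X)) + 1 \<le> card (N t) + card X"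
      using t fX card_gt_0_iff[of X] by fastforce
    moreover have "(\<Sum>u\<in>N t \<inter> V. x u - 1) = int (\<Sum>u\<in>N t. card (N u \<inter> X)) - int (card (N t))"
      using N_sub[OF tV] by (simp add: x_def sum_subtractf Int_absorb2)
    ultimately show "(\<Sum>u\<in>N t \<inter> V. x u - 1) \<le> int (card X) - 1" by linarith
  qed
  finally have upper: "(\<Sum>u\<in>V. (x u - 1) * x u) \<le> int (card X) * (int (card X) - 1)" by simp
  have xv: "x v = 0" by (simp add: x_def X_def)
  have "(\<Sum>u\<in>V - {v}. int q * (int q - 1) - 2 * (int q - 1) * defect u) \<le> (\<Sum>u\<in>V - {v}. (x u - 1) * x u)"
  proof (rule sum_mono)
    fix u assume u: "u \<in> V - {v}"
    have "N u = (N u \<inter> X) \<union> (N u \<inter> N v)" using N_sub[of u] u by (auto simp: X_def)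
    then have "card (N u) \<le> card (N u \<inter> X) + card (N u \<inter> N v)" by (metis card_Un_le)
    also have "card (N u \<inter> N v) \<le> 1" using u v by (intro codeg_le) auto
    finally have "int q - defect u \<le> x u" using card_N[of u] by (simp add: x_def)
    then have "2 * (int q - 1) * (int q - defect u) \<le> 2 * (int q - 1) * x u"
      using q2 by (intro mult_left_mono) auto
    moreover have "0 \<le> (x u - int q) * (x u - int q + 1)"
      by (cases "x u - int q \<ge> 0") (auto intro: mult_nonneg_nonneg mult_nonpos_nonpos)
    ultimately show "int q * (int q - 1) - 2 * (int q - 1) * defect u \<le> (x u - 1) * x u"
      by (simp add: algebra_simps)
  qed
  also have "\<dots> = (\<Sum>u\<in>V. (x u - 1) * x u)"
    using sum.remove[OF finV v, of "\<lambda>u. (x u - 1) * x u"] xv by simp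
  also note upper
  also have "(\<Sum>u\<in>V - {v}. int q * (int q - 1) - 2 * (int q - 1) * defect u)
      = (n - 1) * (int q * (int q - 1)) - 2 * (int q - 1) * (total + k)"
  proof -
    have "(\<Sum>u\<in>V - {v}. defect u) = total + k"
      unfolding total_def k_def using sum.remove[OF finV v, of defect] by simp
    moreover have "int (card (V - {v})) = n - 1" using v finV by (simp add: card_Diff_singleton cardV n_def power2_eq_square)
    ultimately show ?thesis by (simp add: sum_subtractf sum_distrib_left[symmetric])
  qed
  finally have "(n - 1) * (int q * (int q - 1)) - 2 * (int q - 1) * (total + k) \<le> (int q * int q - k) * (int q * int q - k - 1)"
    unfolding cX .
  then have 1: "k * (2 * (int q * int q) - 2 * int q + 1 - k) \<le> 2 * (int q - 1) * total"
    by (simp add: n_def algebra_simps)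
  have "int q * 2 \<le> int q * int q" using q2 by (intro mult_left_mono) auto
  \<comment> \<open>The left-hand side of \<open>1\<close> is concave in \<open>k\<close>, and this
    product is its increase from \<open>k = 2\<close>. Already the value at 2 is too large, while
    \<open>k = 1\<close> is consistent once \<open>total\<close> is at least \<open>q\<close>; so a
    surplus of 1 survives.\<close>
  then have "0 \<le> (k - 2) * (2 * (int q * int q) - 2 * int q - 1 - k)"
    using k2 kq by (intro mult_nonneg_nonneg) auto
  then have "2 * (2 * (int q * int q) - 2 * int q - 1) \<le> 2 * (int q - 1) * total"
    using 1 by (simp add: algebra_simps)
  also have "\<dots> \<le> 2 * (int q - 1) * (2 * int q - 2)"
    using tot q2 by (intro mult_left_mono) auto
  finally show False using q2 by (simp add: algebra_simps)
qed

text \<open>At a vertex of defect -1 the set \<open>unlinked\<close> has nonnegative size only if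
  its deficient neighbours carry at least \<open>q\<close> units of defect. All positive defect
  together is \<open>O(q)\<close>, and each deficient vertex serves only \<open>O(\<surd>q)\<close>
  surplus vertices.\<close>

lemma card_surplus_le:
  assumes ge: "\<And>x. x \<in> V \<Longrightarrow> -1 \<le> defect x" and tot: "total \<le> 2 * int q" and q: "60 \<le> q"
  shows "real (card {x \<in> V. defect x < 0}) \<le> 11 * (4 * sqrt (real q) + 1)"
proof -
  define T where "T = {x \<in> V. defect x < 0}"
  define S where "S = {x \<in> V. 0 < defect x}"
  have TV: "T \<subseteq> V" "finite T" and SV: "S \<subseteq> V" "finite S" using finV by (auto simp: T_def S_def)
  have dT: "defect x = -1" if "x \<in> T" for x using ge[of x] that by (auto simp: T_def)
  define m where "m = int (card T)"
  define P where "P = (\<Sum>s\<in>S. defect s)"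
  have P: "P = total + m"
  proof -
    have "total = (\<Sum>x\<in>T \<union> S. defect x)"
      unfolding total_def using finV by (intro sum.mono_neutral_right) (auto simp: T_def S_def)
    also have "\<dots> = (\<Sum>x\<in>T. defect x) + P"
      unfolding P_def using TV SV by (intro sum.union_disjoint) (auto simp: T_def S_def)
    also have "(\<Sum>x\<in>T. defect x) = - m" using dT by (simp add: m_def)
    finally show ?thesis by simp
  qed
  have SP: "int (card S) \<le> P"
    unfolding P_def using sum_mono[of S "\<lambda>_. 1" defect] by (force simp: S_def)
  have ge_T: "- int (card (A \<inter> T)) \<le> (\<Sum>u\<in>A. defect u) - (\<Sum>u\<in>A \<inter> S. defect u)" if A: "A \<subseteq> V" for A
  proof -
    have fA: "finite A" using A finV finite_subset by blast
    have "(\<Sum>u\<in>A. defect u) = (\<Sum>u\<in>(A \<inter> T) \<union> (A \<inter> S). defect u)"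
      using fA A by (intro sum.mono_neutral_right) (auto simp: T_def S_def)
    also have "\<dots> = (\<Sum>u\<in>A \<inter> T. defect u) + (\<Sum>u\<in>A \<inter> S. defect u)"
      using fA by (intro sum.union_disjoint) (auto simp: T_def S_def)
    also have "(\<Sum>u\<in>A \<inter> T. defect u) = - int (card (A \<inter> T))" using dT by simp
    finally show ?thesis by simp
  qed
  define L where "L = (\<Sum>v\<in>T. card (N v \<inter> S))"
  have L: "L = (\<Sum>s\<in>S. card (N s \<inter> T))" unfolding L_def by (rule edges_between_commute[OF TV(1) SV(1)])
  \<comment> \<open>Compares the sizes of the sets \<open>unlinked s\<close> summed over deficient
    \<open>s\<close> with their sum over all of \<open>V\<close>.\<close>
  have ineq: "int q * m \<le> (int q + 1) * total + int L"
  proof -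
    have "int q * P - int L \<le> (\<Sum>s\<in>S. int q * defect s + ndefect s)"
    proof -
      have "- int (card (N s \<inter> T)) \<le> ndefect s" if "s \<in> S" for s
      proof -
        have "0 \<le> (\<Sum>u\<in>N s \<inter> S. defect u)" by (intro sum_nonneg) (auto simp: S_def)
        then show ?thesis using ge_T[OF N_sub, of s] that SV unfolding ndefect_def by fastforce
      qed
      then have "- int L \<le> (\<Sum>s\<in>S. ndefect s)"
        unfolding L by (simp add: sum_negf[symmetric] sum_mono)
      then show ?thesis by (simp add: sum.distrib sum_distrib_left[symmetric] P_def)
    qed
    also have "\<dots> = (\<Sum>s\<in>S. int (card (unlinked s)))"
      using SV card_unlinked by (intro sum.cong) auto
    also have "\<dots> \<le> (\<Sum>s\<in>V. int (card (unlinked s)))" using SV finV by (intro sum_mono2) auto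
    also have "\<dots> = int q * total + (\<Sum>s\<in>V. ndefect s)"
      using card_unlinked by (simp add: sum.distrib sum_distrib_left[symmetric] total_def)
    also have "(\<Sum>s\<in>V. ndefect s) = (\<Sum>u\<in>V. defect u * (int q + 1 - defect u))"
      using sum_ndefect[OF subset_refl] N_sub by (simp add: Int_absorb2 card_N)
    also have "\<dots> \<le> (\<Sum>u\<in>V. defect u * (int q + 1))"
      by (intro sum_mono) (simp add: algebra_simps)
    also have "\<dots> = total * (int q + 1)" by (simp add: sum_distrib_right total_def)
    finally show ?thesis by (simp add: P algebra_simps)
  qed
  define Q M where "Q = real q" and "M = real (card T)"
  have Q: "60 \<le> Q" and M0: "0 \<le> M" using q by (simp_all add: Q_def M_def)
  have totQ: "real_of_int total \<le> 2 * Q" using tot by (simp add: Q_def)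
  have SM: "real (card S) \<le> 2 * Q + M" using SP P totQ by (simp add: m_def M_def)
  have ST: "real (card S) + M \<le> Q * Q + Q + 1"
  proof -
    have "card S + card T = card (S \<union> T)"
      using TV SV by (intro card_Un_disjoint[symmetric]) (auto simp: T_def S_def)
    also have "\<dots> \<le> card V" using TV SV finV by (intro card_mono) auto
    finally have "real (card S + card T) \<le> real (q\<^sup>2 + q + 1)" unfolding cardV by (rule of_nat_mono)
    then show ?thesis by (simp add: Q_def M_def power2_eq_square)
  qed
  have QQ: "60 * Q \<le> Q * Q" using Q by (intro mult_right_mono) auto
  \<comment> \<open>A crude bound, needed to get \<open>P\<close> down to \<open>O(q)\<close>. The
    edges to \<open>S\<close> absorb at most three quarters of \<open>Q * M\<close>, and the
    remaining quarter of \<open>9 * Q * Q\<close> exceeds \<open>2 * Q * Q\<close>; 60 makes the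
    lower-order terms harmless.\<close>
  have M9: "M \<le> 9 * Q"
  proof (rule ccontr)
    assume nM: "\<not> ?thesis"
    have "16 * real (card S) \<le> 9 * (Q * Q)" using SM ST QQ Q by linarith
    then have "real (card S) \<le> (3 / 4 * Q)\<^sup>2" by (simp add: power2_eq_square)
    then have "sqrt (real (card S)) \<le> 3 / 4 * Q" using Q by (intro real_le_lsqrt) auto
    then have "M * sqrt (real (card S)) \<le> M * (3 / 4 * Q)" using M0 by (rule mult_left_mono)
    moreover have "real L \<le> real (card S) + M * sqrt (real (card S))"
      using edges_between_bound[OF TV(1) SV(1)] by (simp add: L_def M_def)
    moreover have "Q * M \<le> (Q + 1) * real_of_int total + real L"
    proof -
      have "real_of_int (int q * m) \<le> real_of_int ((int q + 1) * total + int L)" using ineq by (simp only: of_int_le_iff)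
      then show ?thesis by (simp add: Q_def M_def m_def)
    qed
    moreover have "(Q + 1) * real_of_int total \<le> (Q + 1) * (2 * Q)"
      using totQ Q by (intro mult_left_mono) auto
    ultimately have "M * (Q / 4 - 1) \<le> 2 * (Q * Q) + 4 * Q" using SM by (simp add: algebra_simps)
    moreover have "9 * Q * (Q / 4 - 1) \<le> M * (Q / 4 - 1)"
      using nM Q by (intro mult_right_mono) auto
    ultimately show False using QQ Q by (simp add: algebra_simps)
  qed
  have P11: "real_of_int P \<le> 11 * Q" using P M9 totQ by (simp add: m_def M_def)
  define w where "w v = (\<Sum>u\<in>N v \<inter> S. defect u)" for v
  have wq: "int q \<le> w v" if "v \<in> T" for v
  proof -
    have vV: "v \<in> V" using that TV by blast
    have "(\<Sum>u\<in>N v. defect u) \<le> w v"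
    proof -
      have "(\<Sum>u\<in>N v. defect u) \<le> (\<Sum>u\<in>N v. if u \<in> S then defect u else 0)"
        using N_in_V[OF vV] by (intro sum_mono) (auto simp: S_def)
      also have "\<dots> = w v" unfolding w_def using finN[OF vV] by (simp add: sum.inter_restrict)
      finally show ?thesis .
    qed
    moreover have "0 \<le> int q * defect v + ndefect v" using card_unlinked[OF vV] by (metis of_nat_0_le_iff)
    ultimately show ?thesis using dT[OF that] by (simp add: ndefect_def)
  qed
  \<comment> \<open>The surplus neighbours of \<open>s\<close> have disjoint deficient
    neighbourhoods apart from \<open>s\<close>, each with at least \<open>q - defect s\<close>
    units. As \<open>s\<close> has only \<open>q + 1 - defect s\<close> neighbours, their number
    \<open>k\<close> satisfies \<open>k * (k - 1) \<le> P\<close>, and 11 is below 16, the square of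
    4.\<close>
  have deg_T: "real (card (N s \<inter> T)) \<le> 4 * sqrt Q + 1" if s: "s \<in> S" for s
  proof -
    have sV: "s \<in> V" using s SV by blast
    define k where "k = int (card (N s \<inter> T))"
    have f: "finite (N s \<inter> T)" using TV by blast
    have "k * (int q - defect s) = (\<Sum>v\<in>N s \<inter> T. int q - defect s)" by (simp add: k_def)
    also have "\<dots> \<le> (\<Sum>v\<in>N s \<inter> T. \<Sum>u\<in>N v \<inter> S - {s}. defect u)"
    proof (rule sum_mono)
      fix v assume v: "v \<in> N s \<inter> T"
      then have "s \<in> N v \<inter> S" using N_sym sV s by blast
      moreover have "finite (N v \<inter> S)" using SV by blast
      ultimately have "w v = defect s + (\<Sum>u\<in>N v \<inter> S - {s}. defect u)"
        unfolding w_def by (intro sum.remove)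
      then show "int q - defect s \<le> (\<Sum>u\<in>N v \<inter> S - {s}. defect u)" using wq[of v] v by simp
    qed
    also have "\<dots> = (\<Sum>u\<in>(\<Union>v\<in>N s \<inter> T. N v \<inter> S - {s}). defect u)"
    proof (rule sum.UNION_disjoint[symmetric])
      show "\<forall>v\<in>N s \<inter> T. \<forall>v'\<in>N s \<inter> T. v \<noteq> v' \<longrightarrow> (N v \<inter> S - {s}) \<inter> (N v' \<inter> S - {s}) = {}"
      proof (intro ballI impI)
        fix v v' assume v: "v \<in> N s \<inter> T" "v' \<in> N s \<inter> T" "v \<noteq> v'"
        then have "v \<in> V" "v' \<in> V" "s \<in> N v" "s \<in> N v'" using TV N_sym[OF sV] by blast+
        then show "(N v \<inter> S - {s}) \<inter> (N v' \<inter> S - {s}) = {}" using codeg[of v v' _ s] v(3) by blast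
      qed
    qed (use f SV in auto)
    also have "\<dots> \<le> P" unfolding P_def using SV by (intro sum_mono2) (auto simp: S_def)
    finally have 1: "k * (int q - defect s) \<le> P" .
    have "k \<le> int (card (N s))" unfolding k_def using finN[OF sV] by (intro of_nat_mono card_mono) auto
    then have "k - 1 \<le> int q - defect s" by (simp add: card_N)
    then have "k * (k - 1) \<le> k * (int q - defect s)" by (intro mult_left_mono) (auto simp: k_def)
    then have "k * (k - 1) \<le> P" using 1 by simp
    then have "real_of_int (k * (k - 1)) \<le> 11 * Q" using P11 by linarith
    then have 2: "real (card (N s \<inter> T)) * (real (card (N s \<inter> T)) - 1) \<le> 11 * Q" by (simp add: k_def)
    show ?thesis
    proof (rule ccontr)
      assume a: "\<not> ?thesis"
      have "(4 * sqrt Q) * (4 * sqrt Q) \<le> real (card (N s \<inter> T)) * (real (card (N s \<inter> T)) - 1)"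
        using a Q by (intro mult_mono) auto
      then show False using 2 Q by simp
    qed
  qed
  have "Q * M = (\<Sum>v\<in>T. Q)" by (simp add: M_def)
  also have "\<dots> \<le> (\<Sum>v\<in>T. real_of_int (w v))"
  proof (rule sum_mono)
    fix v assume "v \<in> T"
    then show "Q \<le> real_of_int (w v)" using wq[of v] unfolding Q_def by linarith
  qed
  also have "\<dots> = real_of_int (\<Sum>v\<in>T. \<Sum>u\<in>N v \<inter> S. defect u)" by (simp add: w_def)
  also have "(\<Sum>v\<in>T. \<Sum>u\<in>N v \<inter> S. defect u) = (\<Sum>u\<in>S. defect u * int (card (N u \<inter> T)))"
    using sum_over_nbrs[OF TV(1) SV(1), of defect] by simp
  also have "real_of_int \<dots> \<le> (\<Sum>u\<in>S. real_of_int (defect u) * (4 * sqrt Q + 1))"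
    using deg_T unfolding of_int_sum of_int_mult of_int_of_nat_eq
    by (intro sum_mono mult_left_mono) (auto simp: S_def)
  also have "\<dots> = real_of_int P * (4 * sqrt Q + 1)" by (simp add: P_def sum_distrib_right)
  also have "\<dots> \<le> 11 * Q * (4 * sqrt Q + 1)" using P11 Q by (intro mult_right_mono) auto
  finally have "Q * M \<le> Q * (11 * (4 * sqrt Q + 1))" by (simp add: algebra_simps)
  then have "M \<le> 11 * (4 * sqrt Q + 1)" using Q by simp
  then show ?thesis by (simp add: M_def Q_def T_def)
qed

end

section \<open>From the relation to the graph\<close>

definition nbrs :: "'a set set \<Rightarrow> 'a \<Rightarrow> 'a set" where
  "nbrs E x = {y. {x, y} \<in> E}"

lemma simple_graph_edge:
  assumes "simple_graph V E" "{x, y} \<in> E"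
  shows "x \<in> V" "y \<in> V" "x \<noteq> y"
  using assms by (auto simp: simple_graph_def)

lemma finite_simple_graph: "simple_graph V E \<Longrightarrow> finite E"
  by (auto simp: simple_graph_def intro: finite_subset[of _ "Pow V"])

lemma finite_nbrs: "simple_graph V E \<Longrightarrow> finite (nbrs E x)"
  using simple_graph_edge[of V E x] by (auto simp: simple_graph_def nbrs_def intro: finite_subset[of _ V])

lemma nbrs_sym: "y \<in> nbrs E x \<Longrightarrow> x \<in> nbrs E y"
  by (simp add: nbrs_def insert_commute)

lemma handshake:
  assumes G: "simple_graph V E"
  shows "(\<Sum>x\<in>V. card (nbrs E x)) = 2 * card E"
proof -
  have fV: "finite V" and fE: "finite E" using G finite_simple_graph by (auto simp: simple_graph_def)
  have "card (nbrs E x) = card {f \<in> E. x \<in> f}" for x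
  proof (rule bij_betw_same_card[of "\<lambda>y. {x, y}"])
    have "f \<in> (\<lambda>y. {x, y}) ` nbrs E x" if f: "f \<in> E" "x \<in> f" for f
    proof -
      have "card f = 2" using G f by (auto simp: simple_graph_def)
      then obtain a b where "f = {a, b}" by (auto simp: card_2_iff)
      then obtain y where "f = {x, y}" using f(2) by (auto simp: insert_commute)
      then show ?thesis using f by (auto simp: nbrs_def)
    qed
    then show "bij_betw (\<lambda>y. {x, y}) (nbrs E x) {f \<in> E. x \<in> f}"
      by (auto simp: bij_betw_def inj_on_def nbrs_def doubleton_eq_iff)
  qed
  then have "(\<Sum>x\<in>V. card (nbrs E x)) = (\<Sum>x\<in>V. \<Sum>f\<in>E. if x \<in> f then 1 else 0)"
    using fE by (simp add: sum.If_cases Int_def)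
  also have "\<dots> = (\<Sum>f\<in>E. \<Sum>x\<in>V. if x \<in> f then 1 else 0)" by (rule sum.swap)
  also have "\<dots> = (\<Sum>f\<in>E. 2)"
  proof (rule sum.cong[OF refl])
    fix f assume "f \<in> E"
    then have "f \<subseteq> V" "card f = 2" using G by (auto simp: simple_graph_def)
    then show "(\<Sum>x\<in>V. if x \<in> f then 1 else 0) = (2::nat)"
      using fV by (simp add: sum.inter_restrict[symmetric] Int_absorb1)
  qed
  finally show ?thesis by simp
qed

lemma c4free_rel_nbrs:
  assumes G: "simple_graph V E" and C4: "C4_free E" and cV: "card V = q\<^sup>2 + q + 1"
  shows "c4free_rel V (nbrs E) q"
proof
  show "finite V" using G by (simp add: simple_graph_def)
  show "card V = q\<^sup>2 + q + 1" by (rule cV)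
  show "nbrs E x \<subseteq> V" for x using simple_graph_edge[OF G] by (auto simp: nbrs_def)
  show "y \<in> nbrs E x \<Longrightarrow> x \<in> nbrs E y" for x y by (rule nbrs_sym)
  show "a = b" if "x \<noteq> y" and ab: "a \<in> nbrs E x" "a \<in> nbrs E y" "b \<in> nbrs E x" "b \<in> nbrs E y" for x y a b
  proof (rule ccontr)
    assume "a \<noteq> b"
    have e: "{x, a} \<in> E" "{a, y} \<in> E" "{y, b} \<in> E" "{b, x} \<in> E"
      using ab by (auto simp: nbrs_def insert_commute)
    then have "distinct [x, a, y, b]"
      using simple_graph_edge(3)[OF G] \<open>x \<noteq> y\<close> \<open>a \<noteq> b\<close> by fastforce
    then show False using C4 e unfolding C4_free_def by blast
  qed
qed

lemma total_nbrs:
  assumes G: "simple_graph V E" and C4: "C4_free E" and cV: "card V = q\<^sup>2 + q + 1"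
  shows "c4free_rel.total V (nbrs E) q = int q * (int q + 1)\<^sup>2 + int q + 1 - 2 * int (card E)"
proof -
  interpret c4free_rel V "nbrs E" q by (rule c4free_rel_nbrs[OF assms])
  have "total = int (card V) * (int q + 1) - int (\<Sum>x\<in>V. card (nbrs E x))"
    by (simp add: total_def defect_def sum_subtractf)
  then show ?thesis unfolding handshake[OF G] by (simp add: cV power2_eq_square algebra_simps)
qed

lemma rel_edges_iff:
  assumes R: "partial_polarity q V V R"
  shows "{x, y} \<in> rel_edges V R \<longleftrightarrow> x \<in> V \<and> y \<in> V \<and> x \<noteq> y \<and> x \<in> R y"
  using partial_polarityD(7)[OF R] by (auto simp: rel_edges_def doubleton_eq_iff)

lemma simple_graph_rel_edges: "finite V \<Longrightarrow> simple_graph V (rel_edges V R)"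
  by (auto simp: simple_graph_def rel_edges_def)

lemma sub_rel_edges_iff:
  assumes R: "partial_polarity q V V R" and G: "simple_graph V E"
  shows "E \<subseteq> rel_edges V R \<longleftrightarrow> (\<forall>x\<in>V. nbrs E x \<subseteq> R x)"
proof
  assume a: "E \<subseteq> rel_edges V R"
  have "y \<in> R x" if "{x, y} \<in> E" for x y
    using that a rel_edges_iff[OF R, of y x] by (auto simp: insert_commute)
  then show "\<forall>x\<in>V. nbrs E x \<subseteq> R x" by (auto simp: nbrs_def)
next
  assume a: "\<forall>x\<in>V. nbrs E x \<subseteq> R x"
  show "E \<subseteq> rel_edges V R"
  proof
    fix f assume f: "f \<in> E"
    then have "card f = 2" using G by (auto simp: simple_graph_def)
    then obtain x y where xy: "f = {x, y}" by (auto simp: card_2_iff)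
    then have "x \<in> nbrs E y" using f by (simp add: nbrs_def insert_commute)
    then show "f \<in> rel_edges V R"
      using simple_graph_edge[OF G, of x y] f a unfolding xy rel_edges_iff[OF R] by blast
  qed
qed

lemma card_rel_edges_le:
  assumes R: "partial_polarity q V V R" and fV: "finite V"
  shows "2 * card (rel_edges V R) \<le> card V * (q + 1)"
proof -
  have "2 * card (rel_edges V R) = (\<Sum>x\<in>V. card (nbrs (rel_edges V R) x))"
    using handshake[OF simple_graph_rel_edges[OF fV]] by simp
  also have "\<dots> \<le> (\<Sum>x\<in>V. card (R x))"
  proof (intro sum_mono card_mono)
    fix x assume x: "x \<in> V"
    show "finite (R x)" using partial_polarityD(4)[OF R x] .
    show "nbrs (rel_edges V R) x \<subseteq> R x"
      using partial_polarityD(7)[OF R] by (auto simp: nbrs_def rel_edges_iff[OF R])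
  qed
  also have "\<dots> = card V * (q + 1)" using partial_polarityD(3)[OF R] by simp
  finally show ?thesis .
qed

text \<open>A vertex \<open>v\<close> of degree at least \<open>q + 2\<close> has a neighbour \<open>t\<close> outside its line \<open>R v\<close>. For almost
  every \<open>s \<in> R v\<close> the polarity graph contains a path \<open>s, y, t\<close>, which together with \<open>v\<close> would form
  a 4-cycle; so one of its two edges is missing from \<open>E\<close>.\<close>

lemma surplus_vertex_missing_edges:
  assumes G: "simple_graph V E" and C4: "C4_free E" and R: "partial_polarity q V V R"
    and E': "E' \<subseteq> E" "E' \<subseteq> rel_edges V R" and v: "v \<in> V" "q + 1 < card (nbrs E v)"
  shows "q + 1 \<le> card (E - E') + card (rel_edges V R - E)"
proof -
  note D = partial_polarityD[OF R]
  define H where "H = rel_edges V R"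
  have fV: "finite V" using G by (simp add: simple_graph_def)
  have fE: "finite E" and fH: "finite H"
    using G finite_simple_graph simple_graph_rel_edges[OF fV] unfolding H_def by blast+
  have fN: "finite (nbrs E v)" using finite_nbrs[OF G] .
  have "\<not> nbrs E v \<subseteq> R v" using card_mono[OF D(4)[OF v(1)], of "nbrs E v"] D(3)[OF v(1)] v(2) by auto
  then obtain t where t: "t \<in> nbrs E v" "t \<notin> R v" by blast
  have tE: "{v, t} \<in> E" using t by (simp add: nbrs_def)
  have tV: "t \<in> V" "v \<noteq> t" using simple_graph_edge[OF G tE] by blast+
  have vt: "v \<notin> R t" using D(7)[OF tV(1)] t v by blast
  define X where "X = nbrs E' v - R t"
  have N'R: "nbrs E' v \<subseteq> R v"
  proof -
    have "simple_graph V E'" using G E'(1) by (auto simp: simple_graph_def)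
    then show ?thesis using sub_rel_edges_iff[OF R] E'(2) v(1) by blast
  qed
  have c1: "card (nbrs E v - nbrs E' v) \<le> card (E - E')"
    by (rule card_inj_on_le[of "\<lambda>y. {v, y}"]) (use fE in \<open>auto simp: inj_on_def nbrs_def doubleton_eq_iff\<close>)
  let ?B = "nbrs E v - nbrs E' v" and ?C = "nbrs E' v \<inter> R t"
  have "nbrs E v = X \<union> (?B \<union> ?C)" using E' by (auto simp: X_def nbrs_def)
  then have "card (nbrs E v) = card (X \<union> (?B \<union> ?C))" by (rule arg_cong)
  also have "\<dots> \<le> card X + card (?B \<union> ?C)" by (rule card_Un_le)
  also have "\<dots> \<le> card X + (card ?B + card ?C)" by (intro add_left_mono card_Un_le)
  finally have "card (nbrs E v) \<le> card X + (card ?B + card ?C)" .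
  moreover have "card ?C \<le> card (R v \<inter> R t)"
    using N'R D(4)[OF v(1)] by (intro card_mono) auto
  moreover have "card (R v \<inter> R t) = 1" using D(5)[OF v(1) tV(1,2)] .
  \<comment> \<open>A neighbour of \<open>v\<close> outside \<open>X\<close> has either lost its
    edge to \<open>v\<close> in \<open>E'\<close> or is the single point of
    \<open>R v \<inter> R t\<close>, which costs one of the at least \<open>q + 2\<close>
    neighbours.\<close>
  ultimately have c2: "q + 1 \<le> card (E - E') + card X" using c1 v(2) by linarith
  have s: "s \<in> V" "s \<noteq> t" "s \<noteq> v" "s \<notin> R t" "v \<in> R s" "{v, s} \<in> E" if "s \<in> X" for s
  proof -
    show se: "{v, s} \<in> E" and "s \<notin> R t" using that E' by (auto simp: X_def nbrs_def)
    show sV: "s \<in> V" and "s \<noteq> v" using simple_graph_edge[OF G se] by blast+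
    have "s \<in> R v" using that N'R by (auto simp: X_def)
    then show "s \<noteq> t" "v \<in> R s" using t D(7) v sV by blast+
  qed
  define y where "y s = (THE y. y \<in> R s \<and> y \<in> R t)" for s
  have y: "y s \<in> R s" "y s \<in> R t" "y s \<in> V" "y s \<noteq> s" "y s \<noteq> t" "y s \<noteq> v" if sX: "s \<in> X" for s
  proof -
    note ss = s[OF sX]
    obtain u where "R s \<inter> R t = {u}" using D(6)[OF ss(1) tV(1) ss(2)] by blast
    then have ex: "\<exists>!y. y \<in> R s \<and> y \<in> R t" by (metis Int_iff singleton_iff)
    show ys: "y s \<in> R s" "y s \<in> R t" using theI'[OF ex] unfolding y_def by auto
    show "y s \<in> V" using ys D(2) tV by blast
    show "y s \<noteq> s" using ys ss by metis
    show "y s \<noteq> t" using ys ss D(7)[OF ss(1) _ tV(1)] by metis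
    show "y s \<noteq> v" using ys vt by metis
  qed
  define f where "f s = (if {s, y s} \<in> E then {y s, t} else {s, y s})" for s
  have fX: "f s \<in> H - E" if sX: "s \<in> X" for s
  proof -
    note ss = s[OF sX] and yy = y[OF sX]
    have "{s, y s} \<in> H" "{y s, t} \<in> H"
      using rel_edges_iff[OF R] ss yy tV D(7) unfolding H_def by metis+
    moreover have "\<not> ({s, y s} \<in> E \<and> {y s, t} \<in> E)"
    proof
      assume "{s, y s} \<in> E \<and> {y s, t} \<in> E"
      moreover have "{t, v} \<in> E" using tE by (simp add: insert_commute)
      moreover have "distinct [v, s, y s, t]" using ss yy tV by auto
      ultimately show False using C4 ss(6) unfolding C4_free_def by blast
    qed
    ultimately show ?thesis by (auto simp: f_def)
  qed
  have inj: "inj_on f X"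
  proof (rule inj_onI, rule ccontr)
    fix s1 s2 assume a: "s1 \<in> X" "s2 \<in> X" "f s1 = f s2" "s1 \<noteq> s2"
    note s1 = s[OF a(1)] y[OF a(1)] and s2 = s[OF a(2)] y[OF a(2)]
    \<comment> \<open>The lines of \<open>s1\<close> and \<open>s2\<close> already meet in
      \<open>v\<close>, so they cannot both pass through the same \<open>y\<close>.\<close>
    have "y s1 \<noteq> y s2"
      using partial_polarity_meet_unique[OF R s1(1) s2(1) a(4) s1(7) _ s1(5) s2(5)] s2(7) s1(12) by metis
    then show False
      using a(3) s1 s2 unfolding f_def by (auto simp: doubleton_eq_iff split: if_splits)
  qed
  have "card X \<le> card (H - E)" using inj fX fH by (intro card_inj_on_le[of f]) auto
  then show ?thesis using c2 by (simp add: H_def)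
qed

theorem theorem3p1:
  fixes c :: real
  assumes "0 < c" and "c < 1"
  shows "\<exists>q\<^sub>c :: nat. \<forall>q \<ge> q\<^sub>c. even q \<longrightarrow>
    (\<forall>(V :: 'a set) E.
       simple_graph V E \<longrightarrow> C4_free E \<longrightarrow> card V = q\<^sup>2 + q + 1 \<longrightarrow>
       real (card E) \<ge> 1/2 * real q * (real q + 1)\<^sup>2 - c/2 * real q \<longrightarrow>
       (\<exists>!F. polarity_graph q V F \<and> E \<subseteq> F))"
proof -
  \<comment> \<open>The total defect is at most \<open>(2 - 2 * e) * q + 1\<close>. Half of the
    slack \<open>2 * e * q\<close> pays for the deleted edges, each of which raises the total by 2;
    the other half is kept for \<open>eventually_unique_polarity\<close>.\<close>
  define e where "e = (1 - c) / 2"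
  have e: "0 < e" using assms by (simp add: e_def)
  have ce: "c = 1 - 2 * e" unfolding e_def by (simp add: field_simps)
  have "eventually (\<lambda>q::nat. 11 * (4 * sqrt (real q) + 1) < e / 2 * real q) at_top"
    using e by real_asymp
  moreover have "eventually (\<lambda>q::nat. real q + 1 + c * real q + 22 * (4 * sqrt (real q) + 1) \<le> (2 - e) * real q) at_top"
    unfolding ce using e by real_asymp
  moreover have "eventually (\<lambda>q::nat. 60 \<le> q) at_top" by (rule eventually_ge_at_top)
  moreover note eventually_unique_polarity[OF e, where ?'a = 'a]
  ultimately have "eventually (\<lambda>q. even q \<longrightarrow> (\<forall>(V :: 'a set) E.
       simple_graph V E \<longrightarrow> C4_free E \<longrightarrow> card V = q\<^sup>2 + q + 1 \<longrightarrow>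
       real (card E) \<ge> 1/2 * real q * (real q + 1)\<^sup>2 - c/2 * real q \<longrightarrow>
       (\<exists>!F. polarity_graph q V F \<and> E \<subseteq> F))) at_top"
  proof eventually_elim
    case (elim q)
    show ?case
    proof (intro impI allI)
      fix V :: "'a set" and E
      assume ev: "even q" and G: "simple_graph V E" and C4: "C4_free E" and cV: "card V = q\<^sup>2 + q + 1"
        and cE: "real (card E) \<ge> 1/2 * real q * (real q + 1)\<^sup>2 - c/2 * real q"
      interpret c4free_rel V "nbrs E" q by (rule c4free_rel_nbrs[OF G C4 cV])
      have loopless: "x \<notin> nbrs E x" for x
        using G by (auto simp: nbrs_def simple_graph_def)
      have tot: "real_of_int total \<le> real q + 1 + c * real q"
        using cE unfolding total_nbrs[OF G C4 cV] by simp
      have "real_of_int (total + 2) \<le> real_of_int (2 * int q)"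
      proof -
        define X where "X = 22 * (4 * sqrt (real q) + 1)"
        have "2 \<le> X" by (simp add: X_def add_increasing)
        moreover have "real q + 1 + c * real q + X \<le> 2 * real q - e * real q"
          using elim(2) by (simp only: left_diff_distrib X_def)
        moreover have "0 \<le> e * real q" using e by auto
        ultimately have "real_of_int total + 2 \<le> 2 * real q" using tot by linarith
        then show ?thesis by simp
      qed
      then have tot2: "total + 2 \<le> 2 * int q" by (simp only: of_int_le_iff)
      have ge: "-1 \<le> defect x" if "x \<in> V" for x
        using defect_ge_minus_1[OF loopless tot2 _ that] elim(3) by simp
      define T where "T = {x \<in> V. defect x < 0}"
      have fT: "finite T" using finV by (simp add: T_def)
      have cT: "real (card T) \<le> 11 * (4 * sqrt (real q) + 1)"
        unfolding T_def using card_surplus_le[OF ge _ elim(3)] tot2 by simp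
      have "\<exists>y. {v, y} \<in> E" if "v \<in> T" for v
      proof -
        have "nbrs E v \<noteq> {}" using that card_N[of v] by (auto simp: T_def)
        then show ?thesis by (auto simp: nbrs_def)
      qed
      then obtain a where a: "\<And>v. v \<in> T \<Longrightarrow> {v, a v} \<in> E" by metis
      \<comment> \<open>One edge per surplus vertex suffices because no defect is below -1.\<close>
      define E' where "E' = E - (\<lambda>v. {v, a v}) ` T"
      have E'E: "E' \<subseteq> E" by (auto simp: E'_def)
      have fE: "finite E" by (rule finite_simple_graph[OF G])
      have G': "simple_graph V E'" using G E'E by (auto simp: simple_graph_def)
      have C4': "C4_free E'" using C4 E'E unfolding C4_free_def by blast
      have "E - E' \<subseteq> (\<lambda>v. {v, a v}) ` T" by (auto simp: E'_def)
      then have cEE': "card (E - E') \<le> card T" using fT surj_card_le by blast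
      have "card E = card E' + card (E - E')"
        using E'E fE by (metis card_Diff_subset card_mono finite_subset le_add_diff_inverse)
      then have cE': "real (card E) \<le> real (card E') + real (card T)" using cEE' by linarith
      have tot': "real_of_int (c4free_rel.total V (nbrs E') q) \<le> (2 - e) * real q"
        using cE cE' cT elim(2) unfolding total_nbrs[OF G' C4' cV] by simp
      have rel': "c4free_rel V (nbrs E') q" by (rule c4free_rel_nbrs[OF G' C4' cV])
      have nn: "0 \<le> c4free_rel.defect (nbrs E') q x" if x: "x \<in> V" for x
      proof -
        have sub: "nbrs E' x \<subseteq> nbrs E x" using E'E by (auto simp: nbrs_def)
        have fx: "finite (nbrs E x)" using finN x by blast
        have "int (card (nbrs E' x)) \<le> int q + 1"
        proof (cases "x \<in> T")
          case True
          then have "nbrs E' x \<subseteq> nbrs E x - {a x}" "a x \<in> nbrs E x"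
            using a by (auto simp: nbrs_def E'_def)
          then have "card (nbrs E' x) \<le> card (nbrs E x) - 1" "0 < card (nbrs E x)"
            using fx card_mono[of "nbrs E x - {a x}" "nbrs E' x"] by (auto simp: card_gt_0_iff)
          then show ?thesis using card_N[of x] ge[OF x] by linarith
        next
          case False
          then show ?thesis using card_mono[OF fx sub] card_N[of x] x by (simp add: T_def)
        qed
        then show ?thesis unfolding c4free_rel.defect_def[OF rel'] by simp
      qed
      have loopless': "\<forall>x\<in>V. x \<notin> nbrs E' x" using loopless E'E by (auto simp: nbrs_def)
      have nn': "\<forall>x\<in>V. 0 \<le> c4free_rel.defect (nbrs E') q x" using nn by blast
      have "\<exists>R. partial_polarity q V V R \<and> (\<forall>x\<in>V. nbrs E' x \<subseteq> R x) \<and>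
        (\<forall>R'. partial_polarity q V V R' \<longrightarrow> (\<forall>x\<in>V. nbrs E' x \<subseteq> R' x) \<longrightarrow> (\<forall>x\<in>V. R' x = R x))"
        by (rule elim(4)[THEN mp, OF ev, THEN spec, THEN spec, THEN mp, OF rel', THEN mp, OF loopless',
              THEN mp, OF nn', THEN mp, OF tot'])
      then obtain R where R: "partial_polarity q V V R" and NR: "\<forall>x\<in>V. nbrs E' x \<subseteq> R x"
        and uniq: "\<forall>R'. partial_polarity q V V R' \<longrightarrow> (\<forall>x\<in>V. nbrs E' x \<subseteq> R' x) \<longrightarrow> (\<forall>x\<in>V. R' x = R x)"
        by blast
      have E'R: "E' \<subseteq> rel_edges V R" using sub_rel_edges_iff[OF R G'] NR by blast
      \<comment> \<open>A surplus vertex would require \<open>q + 1\<close> edges that were deleted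
        or are missing from \<open>E\<close>. Fewer than \<open>e / 2 * q\<close> were deleted, and
        at most half of the total defect of \<open>E'\<close>, hence \<open>(1 - e / 2) * q\<close>,
        are missing. So nothing was deleted, and existence and uniqueness for \<open>E'\<close> are
        those for \<open>E\<close>.\<close>
      have "T = {}"
      proof (rule ccontr)
        assume "T \<noteq> {}"
        then obtain v where v: "v \<in> V" "defect v < 0" by (auto simp: T_def)
        then have "q + 1 < card (nbrs E v)" using card_N[of v] by linarith
        then have 1: "q + 1 \<le> card (E - E') + card (rel_edges V R - E)"
          by (rule surplus_vertex_missing_edges[OF G C4 R E'E E'R v(1)])
        have fH: "finite (rel_edges V R)"
          by (rule finite_simple_graph[OF simple_graph_rel_edges[OF finV]])
        have "card (rel_edges V R - E) \<le> card (rel_edges V R - E')"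
          using fH E'E by (intro card_mono) auto
        also have "\<dots> = card (rel_edges V R) - card E'"
          using E'R fE E'E finite_subset by (intro card_Diff_subset) auto
        finally have "2 * int (card (rel_edges V R - E)) \<le> 2 * int (card (rel_edges V R)) - 2 * int (card E')"
          using card_mono[OF fH E'R] by linarith
        also have "2 * int (card (rel_edges V R)) \<le> int (card V) * (int q + 1)"
        proof -
          have "int (2 * card (rel_edges V R)) \<le> int (card V * (q + 1))"
            using card_rel_edges_le[OF R finV] by (rule of_nat_mono)
          then show ?thesis by (simp add: algebra_simps)
        qed
        finally have "2 * int (card (rel_edges V R - E)) \<le> c4free_rel.total V (nbrs E') q"
          unfolding total_nbrs[OF G' C4' cV] cV by (simp add: algebra_simps power2_eq_square)
        then have "2 * real (card (rel_edges V R - E)) \<le> (2 - e) * real q" using tot' by linarith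
        moreover have "real q + 1 \<le> real (card T) + real (card (rel_edges V R - E))"
          using 1 cEE' by linarith
        ultimately show False using cT elim(1) by (simp add: algebra_simps)
      qed
      then have [simp]: "E' = E" by (simp add: E'_def)
      show "\<exists>!F. polarity_graph q V F \<and> E \<subseteq> F"
      proof (rule ex1I[of _ "rel_edges V R"])
        show "polarity_graph q V (rel_edges V R) \<and> E \<subseteq> rel_edges V R"
          using polarity_graph_of_partial_polarity[OF R cV] E'R elim(3) by simp
      next
        fix F assume F: "polarity_graph q V F \<and> E \<subseteq> F"
        then obtain P where P: "partial_polarity q V V P" "F = rel_edges V P"
          using polarity_graph_imp_partial_polarity by blast
        then have "\<forall>x\<in>V. nbrs E' x \<subseteq> P x" using F sub_rel_edges_iff[OF P(1) G] by simp
        then have "P x = R x" if "x \<in> V" for x using uniq P(1) that by blast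
        then show "F = rel_edges V R" unfolding P(2) rel_edges_def by (intro Collect_cong) metis
      qed
    qed
  qed
  then show ?thesis by (simp only: eventually_at_top_linorder)
qed

end
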